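(* For each integer $n\ge 1$ let $\rho^n=(\rho^n_t)_{t\ge 0}$ be the fraction of occupied servers in the $n$-th system of the sequence of $M_t/G/n/n$ loss models described in the context, all systems starting empty ($\rho^n_0=0$). Then for any $T>0$, $$\lim_{n\to\infty}\ \sup_{t\in[0,T]}\left|\rho^n_t-\rho_t\right|=0\quad\text{almost surely},$$ where $\rho$ is the solution of the non-linear Volterra integral equation $$\rho_t=\int_0^t \mathbf 1_{\{\rho_{u-}<1\}}\,\bar F(t-u)\,\lambda_u\,du\quad\text{for } t>0,\qquad \rho_0=0.$$
   Context: Model. Let $\lambda:[0,\infty)\to[0,\infty)$ be a locally integrable function, and let $F$ be a distribution function on $[0,\infty)$ with density $\nu$ and finite first moment; write $\bar F=1-F$. For each $n\ge1$ the $n$-th system is an $M_t/G/n/n$ loss queue: it has $n$ servers and no waiting buffer. Arrivals occur according to a non-homogeneous Poisson process $A^n$ with intensity $n\lambda_t$ at time $t$, with arrival epochs $T^n_1<T^n_2<\cdots$. The service times $S^n_1,S^n_2,\dots$ are iid with distribution $F$ and independent of $A^n$. An arrival finding all $n$ servers busy is blocked and lost; an arrival finding a free server immediately occupies it for the duration of its service time. The relevant random variables for all $n$ are defined on a common filtered probability space. Fraction of occupied servers. $\rho^n_t$ is the number of busy servers at time $t$ divided by $n$. With the system empty at time $0$, $$\rho^n_t=\frac1n\sum_{i=1}^\infty \mathbf 1_{\{\rho^n_{T^n_i-}<1\}}\,\mathbf 1_{\{S^n_i>t-T^n_i\}}\,\mathbf 1_{\{T^n_i\le t\}}.$$ Notation.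 $f_{u-}$ denotes the left limit of $f$ at $u$. A solution of the Volterra equation is a real-valued function on $[0,\infty)$ with left limits satisfying the equation for every $t>0$ and the stated initial condition.
   Formalization: The existence of a solution ρ of the Volterra equation on [0,∞) is assumed, not asserted; it fails in general (e.g. λ=2 with exponential(1) service times), and the convergence is proved for every solution ρ. *)

theory Defs
  imports "HOL-Probability.Probability"
begin

definition left_lim :: "(real \<Rightarrow> real) \<Rightarrow> real \<Rightarrow> real" where
  "left_lim f u = Lim (at_left u) f"

definition intensity :: "(real \<Rightarrow> real) \<Rightarrow> bool" where
  "intensity lam \<longleftrightarrow>
     (\<forall>t\<ge>0. 0 \<le> lam t) \<and> (\<forall>t\<ge>0. lam absolutely_integrable_on {0..t})"

definition service_distribution :: "(real \<Rightarrow> real) \<Rightarrow> (real \<Rightarrow> real) \<Rightarrow> bool" where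
  "service_distribution F \<nu> \<longleftrightarrow>
     \<nu> \<in> borel_measurable borel \<and> (\<forall>x. 0 \<le> \<nu> x) \<and> (\<forall>x<0. \<nu> x = 0) \<and>
     prob_space (density lborel (\<lambda>x. ennreal (\<nu> x))) \<and> F = cdf (density lborel (\<lambda>x. ennreal (\<nu> x))) \<and>
     integrable lborel (\<lambda>x. x * \<nu> x)"

text \<open>
  Arrivals are numbered from \<open>0\<close>. An epoch is \<open>\<infinity>\<close> if the corresponding arrival never occurs;
  this happens with positive probability whenever the intensity is integrable on the half-line.
\<close>

definition arrival_count :: "(nat \<Rightarrow> 'w \<Rightarrow> ereal) \<Rightarrow> real \<Rightarrow> 'w \<Rightarrow> nat" where
  "arrival_count T t \<omega> = card {i. T i \<omega> \<le> ereal t}"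

definition arrival_epochs :: "'w measure \<Rightarrow> (nat \<Rightarrow> 'w \<Rightarrow> ereal) \<Rightarrow> bool" where
  "arrival_epochs M T \<longleftrightarrow>
     (\<forall>i. T i \<in> borel_measurable M) \<and>
     (\<forall>\<omega>\<in>space M.
        (\<forall>i. 0 < T i \<omega>) \<and>
        (\<forall>i. if T i \<omega> = \<infinity> then T (Suc i) \<omega> = \<infinity> else T i \<omega> < T (Suc i) \<omega>) \<and>
        (\<forall>t. finite {i. T i \<omega> \<le> ereal t}))"

text \<open>
  The Poisson weights are written out because \<^const>\<open>poisson_pmf\<close> is only meaningful for
  positive rates, whereas the mean of an increment may be \<open>0\<close> here.
\<close>

definition (in prob_space) poisson_arrivals ::
    "(real \<Rightarrow> real) \<Rightarrow> (nat \<Rightarrow> 'a \<Rightarrow> ereal) \<Rightarrow> bool" where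
  "poisson_arrivals r T \<longleftrightarrow>
     arrival_epochs M T \<and>
     (\<forall>s t k. 0 \<le> s \<longrightarrow> s \<le> t \<longrightarrow>
        (let m = (LINT u:{s..t}|lebesgue. r u) in
         prob {\<omega>\<in>space M. arrival_count T t \<omega> - arrival_count T s \<omega> = k}
           = m ^ k / fact k * exp (- m))) \<and>
     (\<forall>t::nat \<Rightarrow> real. 0 \<le> t 0 \<longrightarrow> incseq t \<longrightarrow>
        indep_vars (\<lambda>_. count_space UNIV)
          (\<lambda>j \<omega>. arrival_count T (t (Suc j)) \<omega> - arrival_count T (t j) \<omega>) UNIV)"

definition (in prob_space) iid_services ::
    "(real \<Rightarrow> real) \<Rightarrow> (nat \<Rightarrow> 'a \<Rightarrow> real) \<Rightarrow> bool" where
  "iid_services F S \<longleftrightarrow>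
     indep_vars (\<lambda>_. borel) S UNIV \<and> (\<forall>i. cdf (distr M borel (S i)) = F)"

text \<open>
  If \<open>T i \<omega> = \<infinity>\<close>, the last factor vanishes, so the first two factors are irrelevant. Only
  finitely many summands are nonzero.
\<close>

definition occupied_fraction ::
    "'w measure \<Rightarrow> nat \<Rightarrow> (nat \<Rightarrow> 'w \<Rightarrow> ereal) \<Rightarrow> (nat \<Rightarrow> 'w \<Rightarrow> real)
      \<Rightarrow> (real \<Rightarrow> 'w \<Rightarrow> real) \<Rightarrow> bool" where
  "occupied_fraction M n T S R \<longleftrightarrow>
     (\<forall>\<omega>\<in>space M. R 0 \<omega> = 0 \<and>
       (\<forall>t\<ge>0. R t \<omega> = 1 / real n *
         (\<Sum>i. of_bool (left_lim (\<lambda>u. R u \<omega>) (real_of_ereal (T i \<omega>)) < 1)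
              * of_bool (ereal (S i \<omega>) > ereal t - T i \<omega>)
              * of_bool (T i \<omega> \<le> ereal t))))"

definition (in prob_space) loss_system ::
    "nat \<Rightarrow> (real \<Rightarrow> real) \<Rightarrow> (real \<Rightarrow> real) \<Rightarrow> (nat \<Rightarrow> 'a \<Rightarrow> ereal) \<Rightarrow> (nat \<Rightarrow> 'a \<Rightarrow> real)
      \<Rightarrow> (real \<Rightarrow> 'a \<Rightarrow> real) \<Rightarrow> bool" where
  "loss_system n lam F T S R \<longleftrightarrow>
     poisson_arrivals (\<lambda>t. real n * lam t) T \<and>
     iid_services F S \<and>
     indep_var (\<Pi>\<^sub>M i\<in>UNIV. borel) (\<lambda>\<omega> i. S i \<omega>)
               (\<Pi>\<^sub>M t\<in>UNIV. count_space UNIV) (\<lambda>\<omega> t. arrival_count T t \<omega>) \<and>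
     occupied_fraction M n T S R"

text \<open>
  Only the values on the half-line \<open>[0, \<infinity>)\<close> matter. A solution need not exist: for \<open>lam = 2\<close>
  and \<open>F x = 1 - exp (- x)\<close> any solution would be continuous with derivative
  \<open>2 * of_bool (\<rho> < 1) - \<rho>\<close> almost everywhere, and so could not be continued past the time
  \<open>ln 2\<close> at which it reaches \<open>1\<close>.
\<close>

definition volterra_solution ::
    "(real \<Rightarrow> real) \<Rightarrow> (real \<Rightarrow> real) \<Rightarrow> (real \<Rightarrow> real) \<Rightarrow> bool" where
  "volterra_solution lam F \<rho> \<longleftrightarrow>
     (\<forall>t>0. \<exists>l. (\<rho> \<longlongrightarrow> l) (at_left t)) \<and>
     \<rho> 0 = 0 \<and>
     (\<forall>t>0. \<rho> t =
        (LINT u:{0..t}|lebesgue. of_bool (left_lim \<rho> u < 1) * (1 - F (t - u)) * lam u))"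

end

theory Submission
  imports Defs
begin

text \<open>
  The right-hand side of the Volterra equation accepts either all of the arrivals at a given time or
  none of them: the fluid solution \<open>\<rho>\<close> is the occupancy of a fluid system with acceptance set
  \<open>G = {u. \<rho> u < 1}\<close> (lemma \<open>volterra_occupancy\<close>). Because \<open>\<rho>\<close> is given, partial blocking, where
  the choice of the blocked customers could influence the limit, does not occur in the fluid model.
  So it is natural to compare the \<open>n\<close>-th loss system, on the same arrivals and services, with an
  ideal system that accepts an arrival according to its epoch only.

  For the ideal system the law of large numbers is elementary. The arrival counts divided by \<open>n\<close>
  converge by an exponential Chernoff bound for Poisson variables, and the empirical distribution
  functions of the services converge by Hoeffding's lemma. Both bounds are summable in \<open>n\<close>, so
  almost surely both limits hold at all rational arguments (\<open>AE_arrival_fraction\<close>,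
  \<open>AE_empirical_cdf\<close>). On such an outcome the epochs are asymptotically deterministic. Cutting time
  into short cells and using the monotonicity of arrivals and departures, one obtains uniform
  convergence of the ideal occupancy when the acceptance set is a finite union of intervals
  (\<open>typical_cells\<close>).

  The comparison of the two systems is combinatorial (\<open>occupied_near_ideal\<close>). A customer whom only
  the loss system holds was admitted when the ideal system was nearly full; a customer whom only the
  ideal system holds was blocked when the loss system was full and the ideal one was not. The
  difference of the occupancies is bounded above right after an arrival of the first kind, and is
  larger right before one of the second kind. So in between enough surplus customers of the ideal
  system must have left to make room for the next one, and neither surplus can build up. Apart from
  the threshold between the two kinds, which can be taken as small as desired, the only error comes
  from arrivals at times when \<open>\<rho>\<close> is below \<open>1\<close> but very close to it; the mass of these
  times tends to \<open>0\<close> with the width of the band, whatever \<open>G\<close> looks like. This leaves a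
  deterministic convergence theorem (\<open>occupied_converges\<close>) on almost every outcome.
\<close>

section \<open>Exponential moments and almost sure limits\<close>

lemma exp_le_one_plus_square:
  fixes x :: real
  assumes "\<bar>x\<bar> \<le> 1"
  shows "exp x \<le> 1 + x + x\<^sup>2"
proof (cases "0 \<le> x")
  case True
  then show ?thesis
    using exp_bound[of x] assms by simp
next
  case False
  define y where "y = - x"
  have y: "0 < y" "y \<le> 1"
    using False assms by (auto simp: y_def)
  have "1 \<le> (1 - y + y\<^sup>2) * (1 + y)"
    using y by (simp add: algebra_simps power2_eq_square)
  also have "\<dots> \<le> (1 - y + y\<^sup>2) * exp y"
    using y exp_ge_add_one_self[of y] by (intro mult_left_mono) auto
  finally have "exp (- y) \<le> 1 - y + y\<^sup>2"
    by (simp add: exp_minus field_simps)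
  then show ?thesis
    by (simp add: y_def)
qed

text \<open>
  The tool behind both laws of large numbers below: sub-Gaussian moment bounds that grow linearly
  in \<open>n\<close> give exponentially small tails, so Borel--Cantelli applies. Since each tail is bounded
  separately, nothing has to be known about the joint law of the variables for different \<open>n\<close>.
\<close>

lemma (in prob_space) AE_tendsto_zero_of_exp_moments:
  fixes Z :: "nat \<Rightarrow> 'a \<Rightarrow> real"
  assumes meas: "\<And>n. n \<ge> 1 \<Longrightarrow> Z n \<in> borel_measurable M"
    and C: "C \<ge> 0"
    and bound: "\<And>n \<theta>. n \<ge> 1 \<Longrightarrow> \<bar>\<theta>\<bar> \<le> 1 \<Longrightarrow>
      (\<integral>\<^sup>+\<omega>. ennreal (exp (\<theta> * Z n \<omega>)) \<partial>M) \<le> ennreal (exp (real n * C * \<theta>\<^sup>2))"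
  shows "AE \<omega> in M. (\<lambda>n. Z n \<omega> / real n) \<longlonglongrightarrow> 0"
proof -
  have tail: "AE \<omega> in M. eventually (\<lambda>n. \<bar>Z n \<omega>\<bar> < real n * \<epsilon>) sequentially" if \<epsilon>: "\<epsilon> > 0" for \<epsilon>
  proof -
    \<comment> \<open>Small enough that the quadratic term \<open>C * \<theta>\<^sup>2\<close> takes up at most half of the linear gain \<open>\<theta> * \<epsilon>\<close>.\<close>
    define \<theta> where "\<theta> = min 1 (\<epsilon> / (2 * (C + 1)))"
    have \<theta>: "0 < \<theta>" "\<theta> \<le> 1" "\<bar>\<theta>\<bar> \<le> 1"
      using C \<epsilon> by (auto simp: \<theta>_def)
    have "C * \<theta> \<le> (C + 1) * (\<epsilon> / (2 * (C + 1)))"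
      using C \<theta> by (intro mult_mono) (auto simp: \<theta>_def)
    also have "\<dots> = \<epsilon> / 2"
      using C by (simp add: divide_simps)
    finally have C\<theta>: "C * \<theta>\<^sup>2 \<le> \<theta> * \<epsilon> / 2"
      using \<theta> by (simp add: power2_eq_square field_simps mult_left_mono)
    define q where "q = exp (- (\<theta> * \<epsilon> / 2))"
    have q: "0 < q" "q < 1"
      using \<theta> \<epsilon> by (auto simp: q_def)
    define D where "D n = (if n = 0 then {} else {\<omega>\<in>space M. Z n \<omega> \<ge> real n * \<epsilon>} \<union> {\<omega>\<in>space M. - Z n \<omega> \<ge> real n * \<epsilon>})" for n
    have D_sets: "D n \<in> sets M" for n
      using meas[of n] by (cases "n = 0") (auto simp: D_def)
    have one: "emeasure M {\<omega>\<in>space M. f \<omega> \<ge> real n * \<epsilon>} \<le> ennreal (q ^ n)"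
      if n: "n \<ge> 1" and f: "f \<in> borel_measurable M"
        and b: "(\<integral>\<^sup>+\<omega>. ennreal (exp (\<theta> * f \<omega>)) \<partial>M) \<le> ennreal (exp (real n * C * \<theta>\<^sup>2))" for f n
    proof -
      have "emeasure M {\<omega>\<in>space M. f \<omega> \<ge> real n * \<epsilon>}
          \<le> ennreal (exp (- \<theta> * (real n * \<epsilon>))) * (\<integral>\<^sup>+\<omega>. ennreal (exp (\<theta> * f \<omega>)) * indicator (space M) \<omega> \<partial>M)"
        using f \<theta> by (intro Chernoff_ineq_nn_integral_ge) auto
      also have "(\<integral>\<^sup>+\<omega>. ennreal (exp (\<theta> * f \<omega>)) * indicator (space M) \<omega> \<partial>M) = (\<integral>\<^sup>+\<omega>. ennreal (exp (\<theta> * f \<omega>)) \<partial>M)"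
        by (intro nn_integral_cong) auto
      also have "ennreal (exp (- \<theta> * (real n * \<epsilon>))) * \<dots> \<le> ennreal (exp (- \<theta> * (real n * \<epsilon>))) * ennreal (exp (real n * C * \<theta>\<^sup>2))"
        using b by (intro mult_left_mono) auto
      also have "\<dots> = ennreal (exp (real n * (C * \<theta>\<^sup>2 - \<theta> * \<epsilon>)))"
        by (simp flip: ennreal_mult exp_add add: algebra_simps)
      also have "\<dots> \<le> ennreal (exp (real n * (- (\<theta> * \<epsilon> / 2))))"
        using C\<theta> by (intro ennreal_leI iffD2[OF exp_le_cancel_iff] mult_left_mono) auto
      also have "\<dots> = ennreal (q ^ n)"
        by (simp only: q_def exp_of_nat_mult)
      finally show ?thesis .
    qed
    have D_le: "emeasure M (D n) \<le> ennreal (2 * q ^ n)" for n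
    proof (cases "n = 0")
      case False
      then have n: "n \<ge> 1" by simp
      have "emeasure M (D n) \<le> emeasure M {\<omega>\<in>space M. Z n \<omega> \<ge> real n * \<epsilon>} + emeasure M {\<omega>\<in>space M. - Z n \<omega> \<ge> real n * \<epsilon>}"
        using False meas[OF n] unfolding D_def by (simp add: emeasure_subadditive)
      also have "\<dots> \<le> ennreal (q ^ n) + ennreal (q ^ n)"
        using bound[OF n, of \<theta>] bound[OF n, of "- \<theta>"] \<theta> meas[OF n]
        by (intro add_mono one n) auto
      also have "\<dots> = ennreal (2 * q ^ n)"
        using q by (simp flip: ennreal_plus)
      finally show ?thesis .
    qed (simp add: D_def)
    have "measure M (D n) \<le> 2 * q ^ n" for n
      using D_le[of n] q by (simp add: emeasure_eq_measure)
    then have "summable (\<lambda>n. measure M (D n))"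
      using q by (intro summable_comparison_test'[OF summable_mult[OF summable_geometric[of q]]]) auto
    from borel_cantelli_AE1[OF D_sets _ this]
    have "AE \<omega> in M. eventually (\<lambda>n. \<omega> \<in> space M - D n) sequentially"
      by (simp add: emeasure_eq_measure)
    then show ?thesis
    proof (eventually_elim)
      case (elim \<omega>)
      from elim eventually_ge_at_top[of 1]
      show ?case
        by eventually_elim (auto simp: D_def split: if_splits)
    qed
  qed
  have "AE \<omega> in M. \<forall>k. eventually (\<lambda>n. \<bar>Z n \<omega>\<bar> < real n * (1 / real (Suc k))) sequentially"
    unfolding AE_all_countable by (intro allI tail) auto
  then show ?thesis
  proof eventually_elim
    case (elim \<omega>)
    show ?case
    proof (rule LIMSEQ_I)
      fix r :: real assume "r > 0"
      then obtain k where k: "1 / real (Suc k) < r"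
        using nat_approx_posE by blast
      have "eventually (\<lambda>n. \<bar>Z n \<omega>\<bar> < real n * (1 / real (Suc k)) \<and> n \<ge> 1) sequentially"
        using elim eventually_ge_at_top[of 1] by (auto intro: eventually_conj)
      then have "eventually (\<lambda>n. norm (Z n \<omega> / real n - 0) < r) sequentially"
      proof eventually_elim
        case (elim n)
        then have "\<bar>Z n \<omega>\<bar> / real n < 1 / real (Suc k)"
          by (simp add: field_simps)
        with k show ?case by (simp add: abs_divide)
      qed
      then show "\<exists>no. \<forall>n\<ge>no. norm (Z n \<omega> / real n - 0) < r"
        by (simp add: eventually_sequentially)
    qed
  qed
qed

text \<open>
  The centred exponential moment of a Poisson variable is \<open>exp (m * (exp \<theta> - 1 - \<theta>))\<close>. The law is
  given by its weights, so that the degenerate mean \<open>m = 0\<close> is covered.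
\<close>

lemma (in prob_space) poisson_exp_moment_le:
  fixes A :: "'a \<Rightarrow> nat"
  assumes A: "A \<in> measurable M (count_space UNIV)"
    and m: "m \<ge> 0"
    and law: "\<And>k. prob {\<omega>\<in>space M. A \<omega> = k} = m ^ k / fact k * exp (- m)"
    and \<theta>: "\<bar>\<theta>\<bar> \<le> 1"
  shows "(\<integral>\<^sup>+\<omega>. ennreal (exp (\<theta> * (real (A \<omega>) - m))) \<partial>M) \<le> ennreal (exp (m * \<theta>\<^sup>2))"
proof -
  define w where "w k = exp (\<theta> * (real k - m)) * (m ^ k / fact k * exp (- m))" for k
  have w0: "w k \<ge> 0" for k using m by (simp add: w_def)
  have Ak: "{\<omega>\<in>space M. A \<omega> = k} \<in> sets M" for k
    using A by measurable
  have sums: "w sums exp (- (\<theta> * m) - m + exp \<theta> * m)"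
  proof -
    have "(\<lambda>k. (exp \<theta> * m) ^ k /\<^sub>R fact k) sums exp (exp \<theta> * m)"
      by (rule exp_converges)
    then have "(\<lambda>k. exp (- (\<theta> * m) - m) * ((exp \<theta> * m) ^ k /\<^sub>R fact k)) sums (exp (- (\<theta> * m) - m) * exp (exp \<theta> * m))"
      by (rule sums_mult)
    moreover have "exp (- (\<theta> * m) - m) * ((exp \<theta> * m) ^ k /\<^sub>R fact k) = w k" for k
    proof -
      have "exp (\<theta> * (real k - m)) = exp (- (\<theta> * m)) * exp \<theta> ^ k"
        by (simp add: right_diff_distrib exp_diff exp_minus field_simps flip: exp_of_nat2_mult)
      then show ?thesis
        by (simp add: w_def power_mult_distrib exp_diff exp_minus field_simps)
    qed
    ultimately show ?thesis by (simp add: exp_add)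
  qed
  have "(\<integral>\<^sup>+\<omega>. ennreal (exp (\<theta> * (real (A \<omega>) - m))) \<partial>M)
      = (\<integral>\<^sup>+\<omega>. (\<Sum>k. ennreal (exp (\<theta> * (real k - m))) * indicator {\<omega>\<in>space M. A \<omega> = k} \<omega>) \<partial>M)"
  proof (intro nn_integral_cong)
    fix \<omega> assume \<omega>: "\<omega> \<in> space M"
    have "(\<Sum>k. ennreal (exp (\<theta> * (real k - m))) * indicator {\<omega>\<in>space M. A \<omega> = k} \<omega>)
        = (\<Sum>k\<in>{A \<omega>}. ennreal (exp (\<theta> * (real k - m))) * indicator {\<omega>\<in>space M. A \<omega> = k} \<omega>)"
      by (intro suminf_finite) auto
    then show "ennreal (exp (\<theta> * (real (A \<omega>) - m))) = (\<Sum>k. ennreal (exp (\<theta> * (real k - m))) * indicator {\<omega>\<in>space M. A \<omega> = k} \<omega>)"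
      using \<omega> by simp
  qed
  also have "\<dots> = (\<Sum>k. \<integral>\<^sup>+\<omega>. ennreal (exp (\<theta> * (real k - m))) * indicator {\<omega>\<in>space M. A \<omega> = k} \<omega> \<partial>M)"
    using Ak by (intro nn_integral_suminf) auto
  also have "\<dots> = (\<Sum>k. ennreal (w k))"
  proof (intro suminf_cong)
    fix k
    have "(\<integral>\<^sup>+\<omega>. ennreal (exp (\<theta> * (real k - m))) * indicator {\<omega>\<in>space M. A \<omega> = k} \<omega> \<partial>M)
        = ennreal (exp (\<theta> * (real k - m))) * ennreal (m ^ k / fact k * exp (- m))"
      using Ak[of k] by (subst nn_integral_cmult_indicator) (auto simp: emeasure_eq_measure law)
    then show "(\<integral>\<^sup>+\<omega>. ennreal (exp (\<theta> * (real k - m))) * indicator {\<omega>\<in>space M. A \<omega> = k} \<omega> \<partial>M) = ennreal (w k)"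
      unfolding w_def using m by (subst ennreal_mult) auto
  qed
  also have "\<dots> = ennreal (exp (- (\<theta> * m) - m + exp \<theta> * m))"
    using sums w0 by (metis suminf_ennreal2 sums_iff)
  also have "\<dots> \<le> ennreal (exp (m * \<theta>\<^sup>2))"
  proof (intro ennreal_leI iffD2[OF exp_le_cancel_iff])
    have "exp \<theta> * m \<le> (1 + \<theta> + \<theta>\<^sup>2) * m"
      using exp_le_one_plus_square[OF \<theta>] m by (rule mult_right_mono)
    then show "- (\<theta> * m) - m + exp \<theta> * m \<le> m * \<theta>\<^sup>2"
      by (simp add: algebra_simps)
  qed
  finally show ?thesis .
qed

text \<open>
  Hoeffding's lemma for exponents of either sign, by passing to \<open>- f\<close>.
\<close>

lemma (in interval_bounded_random_variable) Hoeffdings_lemma_abs: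
  "(\<integral>\<^sup>+\<omega>. ennreal (exp (\<theta> * (f \<omega> - expectation f))) \<partial>M) \<le> ennreal (exp (\<theta>\<^sup>2 * (b - a)\<^sup>2 / 8))"
proof -
  consider "\<theta> > 0" | "\<theta> = 0" | "\<theta> < 0" by linarith
  then show ?thesis
  proof cases
    case 1
    then show ?thesis by (rule Hoeffdings_lemma_nn_integral)
  next
    case 2
    then show ?thesis using emeasure_space_1 by simp
  next
    case 3
    interpret neg: interval_bounded_random_variable M "\<lambda>\<omega>. - f \<omega>" "- b" "- a"
      by unfold_locales (auto intro: eventually_mono[OF AE_in_interval])
    have "(\<integral>\<^sup>+\<omega>. ennreal (exp ((- \<theta>) * (- f \<omega> - expectation (\<lambda>\<omega>. - f \<omega>)))) \<partial>M)
        \<le> ennreal (exp ((- \<theta>)\<^sup>2 * (- a - - b)\<^sup>2 / 8))"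
      using 3 by (intro neg.Hoeffdings_lemma_nn_integral) auto
    then show ?thesis by (simp add: algebra_simps power2_eq_square)
  qed
qed

lemma (in prob_space) empirical_exp_moment_le:
  fixes S :: "nat \<Rightarrow> 'a \<Rightarrow> real"
  assumes indep: "indep_vars (\<lambda>_. borel) S UNIV"
    and law: "\<And>i. cdf (distr M borel (S i)) = F"
  shows "(\<integral>\<^sup>+\<omega>. ennreal (exp (\<theta> * (\<Sum>i<k. of_bool (S i \<omega> \<le> x) - F x))) \<partial>M) \<le> ennreal (exp (real k * \<theta>\<^sup>2))"
proof -
  define X where "X i \<omega> = of_bool (S i \<omega> \<le> x) - F x" for i \<omega>
  have S [measurable]: "S i \<in> borel_measurable M" for i
    using indep by (auto simp: indep_vars_def)
  have mean: "expectation (\<lambda>\<omega>. of_bool (S i \<omega> \<le> x)) = F x" for i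
  proof -
    have "expectation (\<lambda>\<omega>. of_bool (S i \<omega> \<le> x)) = expectation (indicator {\<omega>\<in>space M. S i \<omega> \<le> x})"
      by (intro Bochner_Integration.integral_cong) auto
    also have "\<dots> = measure (distr M borel (S i)) {..x}"
      by (subst measure_distr) (auto intro!: arg_cong[of _ _ prob])
    also have "\<dots> = F x"
      using law[of i] by (simp add: cdf_def fun_eq_iff)
    finally show ?thesis .
  qed
  have one: "(\<integral>\<^sup>+\<omega>. ennreal (exp (\<theta> * X i \<omega>)) \<partial>M) \<le> ennreal (exp (\<theta>\<^sup>2))" for i
  proof -
    interpret interval_bounded_random_variable M "\<lambda>\<omega>. of_bool (S i \<omega> \<le> x)" 0 1
      by unfold_locales auto
    have "(\<integral>\<^sup>+\<omega>. ennreal (exp (\<theta> * X i \<omega>)) \<partial>M) \<le> ennreal (exp (\<theta>\<^sup>2 / 8))"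
      using Hoeffdings_lemma_abs[of \<theta>] unfolding mean X_def by simp
    also have "\<dots> \<le> ennreal (exp (\<theta>\<^sup>2))"
      by (intro ennreal_leI) simp
    finally show ?thesis .
  qed
  have "indep_vars (\<lambda>_. borel) (\<lambda>i. (\<lambda>y. exp (\<theta> * (of_bool (y \<le> x) - F x))) \<circ> S i) {..<k}"
    by (rule indep_vars_compose[OF indep_vars_subset[OF indep]]) (auto simp: of_bool_def)
  then have ind: "indep_vars (\<lambda>_. borel) (\<lambda>i \<omega>. exp (\<theta> * X i \<omega>)) {..<k}"
    by (simp add: o_def X_def)
  have "(\<integral>\<^sup>+\<omega>. ennreal (exp (\<theta> * (\<Sum>i<k. X i \<omega>))) \<partial>M)
      = (\<integral>\<^sup>+\<omega>. (\<Prod>i<k. ennreal (exp (\<theta> * X i \<omega>))) \<partial>M)"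
    by (simp add: sum_distrib_left exp_sum prod_ennreal)
  also have "\<dots> = (\<Prod>i<k. \<integral>\<^sup>+\<omega>. ennreal (exp (\<theta> * X i \<omega>)) \<partial>M)"
    by (rule indep_vars_nn_integral[OF _ indep_vars_compose2[OF ind]]) auto
  also have "\<dots> \<le> (\<Prod>i<k. ennreal (exp (\<theta>\<^sup>2)))"
    by (intro prod_mono_ennreal one)
  also have "\<dots> = ennreal (exp (real k * \<theta>\<^sup>2))"
    by (simp add: ennreal_power exp_of_nat_mult)
  finally show ?thesis unfolding X_def .
qed

text \<open>
  A law of large numbers for a triangular array: row \<open>n\<close> is the sequence of service times of the
  \<open>n\<close>-th system, and the first \<open>y * n\<close> entries of the row are averaged.
\<close>

lemma (in prob_space) AE_empirical_cdf:
  fixes S :: "nat \<Rightarrow> nat \<Rightarrow> 'a \<Rightarrow> real"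
  assumes indep: "\<And>n. n \<ge> 1 \<Longrightarrow> indep_vars (\<lambda>_. borel) (S n) UNIV"
    and law: "\<And>n i. n \<ge> 1 \<Longrightarrow> cdf (distr M borel (S n i)) = F"
    and y: "y \<ge> 0"
  shows "AE \<omega> in M. (\<lambda>n. (\<Sum>i<nat \<lfloor>y * real n\<rfloor>. of_bool (S n i \<omega> \<le> x)) / real n) \<longlonglongrightarrow> y * F x"
proof -
  define k where "k n = nat \<lfloor>y * real n\<rfloor>" for n
  have k: "real (k n) \<le> y * real n" "y * real n - 1 \<le> real (k n)" for n
    using y unfolding k_def by (auto simp: of_nat_nat)
  have "AE \<omega> in M. (\<lambda>n. (\<Sum>i<k n. of_bool (S n i \<omega> \<le> x) - F x) / real n) \<longlonglongrightarrow> 0"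
  proof (rule AE_tendsto_zero_of_exp_moments[OF _ y])
    fix n :: nat assume n: "n \<ge> 1"
    have [measurable]: "S n i \<in> borel_measurable M" for i
      using indep[OF n] by (auto simp: indep_vars_def)
    show "(\<lambda>\<omega>. \<Sum>i<k n. of_bool (S n i \<omega> \<le> x) - F x) \<in> borel_measurable M"
      unfolding of_bool_def by measurable
    fix \<theta> :: real
    have "(\<integral>\<^sup>+\<omega>. ennreal (exp (\<theta> * (\<Sum>i<k n. of_bool (S n i \<omega> \<le> x) - F x))) \<partial>M) \<le> ennreal (exp (real (k n) * \<theta>\<^sup>2))"
      by (rule empirical_exp_moment_le[OF indep[OF n] law[OF n]])
    also have "\<dots> \<le> ennreal (exp (real n * y * \<theta>\<^sup>2))"
      using k(1)[of n] by (intro ennreal_leI iffD2[OF exp_le_cancel_iff] mult_right_mono) (auto simp: mult.commute)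
    finally show "(\<integral>\<^sup>+\<omega>. ennreal (exp (\<theta> * (\<Sum>i<k n. of_bool (S n i \<omega> \<le> x) - F x))) \<partial>M) \<le> \<dots>" .
  qed
  then show ?thesis
  proof eventually_elim
    case (elim \<omega>)
    have "(\<lambda>n. real (k n) / real n) \<longlonglongrightarrow> y"
    proof (rule tendsto_sandwich)
      have "y - 1 / real n \<le> real (k n) / real n" if "n > 0" for n
        using divide_right_mono[OF k(2), of "real n" n] that by (simp add: diff_divide_distrib)
      then show "eventually (\<lambda>n. y - 1 / real n \<le> real (k n) / real n) sequentially"
        by (intro eventually_mono[OF eventually_gt_at_top[of 0]])
      show "eventually (\<lambda>n. real (k n) / real n \<le> y) sequentially"
        using k(1) by (intro eventually_mono[OF eventually_gt_at_top[of 0]]) (simp add: field_simps)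
      show "(\<lambda>n. y - 1 / real n) \<longlonglongrightarrow> y"
        using tendsto_diff[OF tendsto_const lim_1_over_n, of y] by simp
    qed simp
    from tendsto_add[OF elim tendsto_mult_right[OF this, of "F x"]]
    show ?case
      by (simp add: k_def[symmetric] sum_subtractf diff_divide_distrib)
  qed
qed

section \<open>Fluid occupancy\<close>

text \<open>
  Polya's argument: between two neighbouring points of a fine grid a monotone function is trapped
  by its values there, and the limit hardly moves. Rational points suffice, which makes the lemma
  usable after an almost sure statement on a countable set.
\<close>

lemma monotone_uniform_limit:
  fixes f :: "nat \<Rightarrow> real \<Rightarrow> real" and g :: "real \<Rightarrow> real"
  assumes mono: "\<And>n. n \<ge> 1 \<Longrightarrow> mono (f n)"
    and cont: "\<And>x. isCont g x"
    and pointwise: "\<And>q. q \<in> \<rat> \<Longrightarrow> 0 \<le> q \<Longrightarrow> q \<le> H + 1 \<Longrightarrow> (\<lambda>n. f n q) \<longlonglongrightarrow> g q"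
    and \<epsilon>: "\<epsilon> > 0"
  shows "eventually (\<lambda>n. \<forall>t\<in>{0..H}. \<bar>f n t - g t\<bar> \<le> \<epsilon>) sequentially"
proof -
  have "uniformly_continuous_on {0..H + 1} g"
    using cont by (intro compact_uniformly_continuous continuous_at_imp_continuous_on) auto
  then have "\<exists>\<delta>>0. \<forall>u\<in>{0..H + 1}. \<forall>v\<in>{0..H + 1}. dist v u < \<delta> \<longrightarrow> dist (g v) (g u) < \<epsilon> / 2"
    unfolding uniformly_continuous_on_def using half_gt_zero[OF \<epsilon>] by blast
  then obtain \<delta> where \<delta>: "\<delta> > 0"
    and uc: "\<And>u v. u \<in> {0..H + 1} \<Longrightarrow> v \<in> {0..H + 1} \<Longrightarrow> \<bar>u - v\<bar> < \<delta> \<Longrightarrow> \<bar>g u - g v\<bar> < \<epsilon> / 2"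
    unfolding dist_real_def by blast
  obtain m :: nat where "1 / real (Suc m) < min \<delta> 1"
    using nat_approx_posE[of "min \<delta> 1"] \<delta> by auto
  then have m1: "1 / real (Suc m) < \<delta>" and m2: "1 / real (Suc m) < 1"
    by (auto simp del: of_nat_Suc)
  define p where "p k = real k / real (Suc m)" for k :: nat
  define K where "K = nat \<lceil>(H + 1) * real (Suc m)\<rceil>"
  have "eventually (\<lambda>n. \<forall>k\<in>{k. k \<le> K \<and> p k \<le> H + 1}. \<bar>f n (p k) - g (p k)\<bar> < \<epsilon> / 2) sequentially"
  proof (intro eventually_ball_finite ballI)
    fix k assume k: "k \<in> {k. k \<le> K \<and> p k \<le> H + 1}"
    have "(\<lambda>n. f n (p k)) \<longlonglongrightarrow> g (p k)"
      using k by (intro pointwise) (auto simp: p_def)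
    from tendstoD[OF this, of "\<epsilon> / 2"] \<epsilon>
    show "eventually (\<lambda>n. \<bar>f n (p k) - g (p k)\<bar> < \<epsilon> / 2) sequentially"
      by (simp add: dist_real_def)
  qed auto
  with eventually_ge_at_top[of 1] show ?thesis
  proof eventually_elim
    case (elim n)
    show ?case
    proof
      fix t assume t: "t \<in> {0..H}"
      define k where "k = nat \<lfloor>t * real (Suc m)\<rfloor>"
      have k_le: "real k \<le> t * real (Suc m)" and k_gt: "t * real (Suc m) < real k + 1"
        using t by (auto simp: k_def intro!: mult_nonneg_nonneg)
      have pk: "p k \<le> t" "t < p (Suc k)" "p (Suc k) = p k + 1 / real (Suc m)" "0 \<le> p k"
        using k_le k_gt by (auto simp: p_def field_simps)
      have le: "p (Suc k) \<le> H + 1"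
        using pk m2 t unfolding atLeastAtMost_iff by linarith
      then have "Suc k \<le> K"
        unfolding K_def by (simp add: p_def field_simps) linarith
      then have grid: "\<bar>f n (p k) - g (p k)\<bar> < \<epsilon> / 2" "\<bar>f n (p (Suc k)) - g (p (Suc k))\<bar> < \<epsilon> / 2"
        using elim(2) le pk by auto
      have "\<bar>g t - g (p k)\<bar> < \<epsilon> / 2"
        using pk m1 m2 t by (intro uc) (auto simp del: of_nat_Suc)
      moreover have "\<bar>g (p (Suc k)) - g t\<bar> < \<epsilon> / 2"
        using pk m1 t le by (intro uc) (auto simp del: of_nat_Suc)
      moreover have "f n (p k) \<le> f n t" "f n t \<le> f n (p (Suc k))"
        using mono[OF elim(1)] pk by (auto simp: mono_def)
      ultimately show "\<bar>f n t - g t\<bar> \<le> \<epsilon>"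
        using grid by linarith
    qed
  qed
qed

lemma left_lim_eqI: "(f \<longlongrightarrow> l) (at_left u) \<Longrightarrow> left_lim f u = l"
  unfolding left_lim_def by (intro tendsto_Lim) auto

text \<open>
  The integrand of the Volterra equation involves the solution through its left limits, and its
  measurability has to come from their existence alone: the left limit at \<open>u\<close> is the limit of the
  values at the largest multiple of \<open>1 / n\<close> strictly below \<open>u\<close>, as \<open>n\<close> grows.
\<close>

lemma left_lim_measurable:
  fixes f :: "real \<Rightarrow> real"
  assumes "\<And>u. u > 0 \<Longrightarrow> \<exists>l. (f \<longlongrightarrow> l) (at_left u)"
  shows "(\<lambda>u. if 0 < u then left_lim f u else 0) \<in> borel_measurable borel"
proof (rule borel_measurable_LIMSEQ_real)
  define p where "p n u = (real_of_int \<lceil>real (Suc n) * u\<rceil> - 1) / real (Suc n)" for n u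
  show "(\<lambda>n. if 0 < u then f (p n u) else 0) \<longlonglongrightarrow> (if 0 < u then left_lim f u else 0)" for u
  proof (cases "0 < u")
    case True
    then obtain l where l: "(f \<longlongrightarrow> l) (at_left u)" using assms by blast
    have upper: "p n u < u" for n
      unfolding p_def by (subst pos_divide_less_eq) (simp_all del: of_nat_Suc add: mult.commute, linarith)
    have lower: "u - 1 / real (Suc n) \<le> p n u" for n
    proof -
      have "u - 1 / real (Suc n) = (real (Suc n) * u - 1) / real (Suc n)"
        by (simp add: field_simps)
      also have "\<dots> \<le> p n u"
        unfolding p_def by (intro divide_right_mono) auto
      finally show ?thesis .
    qed
    have "(\<lambda>n. u - 1 / real (Suc n)) \<longlonglongrightarrow> u - 0"
      by (intro tendsto_diff tendsto_const LIMSEQ_Suc lim_1_over_n)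
    then have lim: "(\<lambda>n. p n u) \<longlonglongrightarrow> u"
      by (intro tendsto_sandwich[of "\<lambda>n. u - 1 / real (Suc n)" "\<lambda>n. p n u" _ "\<lambda>n. u"])
        (auto simp: lower upper less_imp_le simp del: of_nat_Suc)
    have "filterlim (\<lambda>n. p n u) (at_left u) sequentially"
      unfolding filterlim_at using lim upper by (auto simp: less_imp_neq)
    then have "(\<lambda>n. f (p n u)) \<longlonglongrightarrow> l"
      using filterlim_compose[OF l] by blast
    then show ?thesis using True left_lim_eqI[OF l] by simp
  qed simp
  fix n
  define h where "h i = f ((real_of_int i - 1) / real (Suc n))" for i
  have "(\<lambda>u. h \<lceil>real (Suc n) * u\<rceil>) \<in> borel_measurable borel"
    by (rule measurable_compose[of _ _ "count_space UNIV"]) auto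
  then show "(\<lambda>u. if 0 < u then f (p n u) else 0) \<in> borel_measurable borel"
    unfolding p_def h_def[symmetric] by measurable
qed

text \<open>
  The fluid model: customers arrive according to the continuous measure \<open>L\<close> (the intensity on a
  bounded horizon) and have service distribution function \<open>F\<close>. If exactly those arriving at times
  in \<open>G\<close> are accepted, then \<open>fluid_departed G t\<close> is the mass that has left by time \<open>t\<close>. Arrivals
  after \<open>t\<close> do not contribute to that integral, because \<open>F\<close> vanishes on the negative half-line.
\<close>

locale fluid_input = finite_borel_measure L for L :: "real measure" +
  fixes F :: "real \<Rightarrow> real"
  assumes L_atomless: "measure L {x} = 0"
    and L_nonpos: "measure L {..0} = 0"
    and F_mono: "mono F"
    and F_cont: "isCont F x"
    and F_nonpos: "x \<le> 0 \<Longrightarrow> F x = 0"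
    and F_le_1: "F x \<le> 1"
begin

definition fluid_departed :: "real set \<Rightarrow> real \<Rightarrow> real" where
  "fluid_departed G t = (LINT u|L. indicator G u * F (t - u))"

definition fluid_occupancy :: "real set \<Rightarrow> real \<Rightarrow> real" where
  "fluid_occupancy G t = measure L (G \<inter> {..t}) - fluid_departed G t"

declare M_is_borel [measurable_cong]

lemma F_nonneg: "0 \<le> F x"
  using monoD[OF F_mono, of "min x 0" x] F_nonpos[of "min x 0"] by simp

lemma F_measurable [measurable]: "F \<in> borel_measurable borel"
  by (rule borel_measurable_mono[OF F_mono])

lemma cdf_L_nonpos: "t \<le> 0 \<Longrightarrow> cdf L t = 0"
  using cdf_nondecreasing[of t 0] cdf_nonneg[of t] L_nonpos by (auto simp: cdf_def intro: antisym)

lemma isCont_cdf_L: "isCont (cdf L) t"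
  using isCont_cdf L_atomless by blast

lemma integrable_departed:
  assumes [measurable]: "G \<in> sets borel"
  shows "integrable L (\<lambda>u. indicator G u * F (t - u))"
  by (rule integrable_const_bound[where B = 1])
    (auto simp: indicator_def abs_mult F_nonneg F_le_1)

lemma isCont_fluid_departed:
  assumes [measurable]: "G \<in> sets borel"
  shows "isCont (fluid_departed G) t"
  unfolding isCont_def fluid_departed_def
proof (rule tendsto_at_iff_sequentially[THEN iffD2], intro allI impI, unfold o_def)
  fix X :: "nat \<Rightarrow> real" assume X: "X \<longlonglongrightarrow> t"
  show "(\<lambda>n. LINT u|L. indicator G u * F (X n - u)) \<longlonglongrightarrow> (LINT u|L. indicator G u * F (t - u))"
  proof (rule integral_dominated_convergence[where w = "\<lambda>_. 1"])
    show "AE u in L. (\<lambda>n. indicator G u * F (X n - u)) \<longlonglongrightarrow> indicator G u * F (t - u)"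
      using X F_cont by (intro AE_I2 tendsto_mult tendsto_const isCont_tendsto_compose[of _ F] tendsto_diff)
  qed (auto simp: indicator_def F_nonneg F_le_1)
qed

lemma isCont_measure_atMost:
  assumes G [measurable]: "G \<in> sets borel"
  shows "isCont (\<lambda>y. measure L (G \<inter> {..y})) t"
proof -
  have split: "measure L (B \<inter> {..y}) = measure L (B \<inter> {..z}) + measure L (B \<inter> {z<..y})"
    if "z \<le> y" and [measurable]: "B \<in> sets borel" for B y z
  proof -
    have "B \<inter> {..y} = (B \<inter> {..z}) \<union> (B \<inter> {z<..y})" using that(1) by auto
    also have "measure L \<dots> = measure L (B \<inter> {..z}) + measure L (B \<inter> {z<..y})"
      by (rule finite_measure_Union) auto
    finally show ?thesis .
  qed
  have le: "\<bar>measure L (G \<inter> {..y}) - measure L (G \<inter> {..z})\<bar> \<le> \<bar>cdf L y - cdf L z\<bar>" if "z \<le> y" for y z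
  proof -
    have "measure L (G \<inter> {z<..y}) \<le> measure L {z<..y}"
      by (intro finite_measure_mono) auto
    then show ?thesis
      using split[OF that G] split[OF that, of UNIV] measure_nonneg[of L "G \<inter> {z<..y}"] by (simp add: cdf_def)
  qed
  have bound: "norm (measure L (G \<inter> {..y}) - measure L (G \<inter> {..t})) \<le> \<bar>cdf L y - cdf L t\<bar>" for y
    unfolding real_norm_def
  proof (cases "t \<le> y")
    case False
    then have "y \<le> t" by simp
    from le[OF this] show "\<bar>measure L (G \<inter> {..y}) - measure L (G \<inter> {..t})\<bar> \<le> \<bar>cdf L y - cdf L t\<bar>"
      by linarith
  qed (rule le)
  have lim: "((\<lambda>y. \<bar>cdf L y - cdf L t\<bar>) \<longlongrightarrow> 0) (at t)"
    using isCont_cdf_L[of t] by (simp add: isCont_def LIM_zero_iff tendsto_rabs_zero_iff)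
  have "((\<lambda>y. measure L (G \<inter> {..y}) - measure L (G \<inter> {..t})) \<longlongrightarrow> 0) (at t)"
    by (rule Lim_null_comparison[OF always_eventually[OF allI[OF bound]] lim])
  then show ?thesis
    unfolding isCont_def LIM_zero_iff .
qed

lemma isCont_fluid_occupancy:
  assumes "G \<in> sets borel"
  shows "isCont (fluid_occupancy G) t"
  unfolding fluid_occupancy_def[abs_def]
  by (rule continuous_diff[OF isCont_measure_atMost[OF assms] isCont_fluid_departed[OF assms]])

lemma fluid_occupancy_eq_integral:
  assumes [measurable]: "G \<in> sets borel"
  shows "fluid_occupancy G t = (LINT u|L. indicator (G \<inter> {..t}) u * (1 - F (t - u)))"
proof -
  have "(LINT u|L. indicator (G \<inter> {..t}) u * (1 - F (t - u)))
      = (LINT u|L. indicator (G \<inter> {..t}) u - indicator G u * F (t - u))"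
    by (intro Bochner_Integration.integral_cong) (auto simp: indicator_def F_nonpos)
  also have "\<dots> = measure L (G \<inter> {..t}) - fluid_departed G t"
    using integrable_departed[OF assms, of t] unfolding fluid_departed_def
    by (subst Bochner_Integration.integral_diff) (auto simp: borel_UNIV emeasure_eq_measure)
  finally show ?thesis by (simp add: fluid_occupancy_def)
qed

text \<open>
  Removing arrivals from \<open>G\<close> lowers the occupancy by at most their mass. This is what allows an
  open acceptance set to be replaced by a finite union of intervals.
\<close>

lemma fluid_occupancy_mono_set:
  assumes G [measurable]: "G \<in> sets borel" and C [measurable]: "C \<in> sets borel"
    and sub: "C \<inter> {0<..t} \<subseteq> G"
  shows "fluid_occupancy C t \<le> fluid_occupancy G t"
    and "fluid_occupancy G t - fluid_occupancy C t \<le> measure L ((G - C) \<inter> {0<..t})"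
proof -
  have pos: "AE u in L. 0 < u"
    using L_nonpos by (intro AE_I[of _ _ "{..0}"]) (auto simp: emeasure_eq_measure borel_UNIV)
  have int: "integrable L (\<lambda>u. indicator (B \<inter> {..t}) u * (1 - F (t - u)))" if [measurable]: "B \<in> sets borel" for B
    by (rule integrable_const_bound[where B = 1])
      (auto simp: indicator_def abs_mult F_nonneg F_le_1)
  show "fluid_occupancy C t \<le> fluid_occupancy G t"
    unfolding fluid_occupancy_eq_integral[OF G] fluid_occupancy_eq_integral[OF C]
  proof (rule integral_mono_AE[OF int[OF C] int[OF G]])
    show "AE u in L. indicator (C \<inter> {..t}) u * (1 - F (t - u)) \<le> indicator (G \<inter> {..t}) u * (1 - F (t - u))"
      using pos
    proof eventually_elim
      case (elim u)
      have "u \<in> C \<Longrightarrow> u \<le> t \<Longrightarrow> u \<in> G" using sub elim by auto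
      moreover have "0 \<le> 1 - F (t - u)" using F_le_1[of "t - u"] by simp
      ultimately show ?case
        by (cases "u \<in> C"; cases "u \<in> G"; cases "u \<le> t") simp_all
    qed
  qed
  have "fluid_occupancy G t - fluid_occupancy C t
      = (LINT u|L. indicator (G \<inter> {..t}) u * (1 - F (t - u)) - indicator (C \<inter> {..t}) u * (1 - F (t - u)))"
    unfolding fluid_occupancy_eq_integral[OF G] fluid_occupancy_eq_integral[OF C]
    by (intro Bochner_Integration.integral_diff[symmetric] int G C)
  also have "\<dots> \<le> (LINT u|L. indicator ((G - C) \<inter> {0<..t}) u)"
  proof (rule integral_mono_AE)
    show "integrable L (\<lambda>u. indicator (G \<inter> {..t}) u * (1 - F (t - u)) - indicator (C \<inter> {..t}) u * (1 - F (t - u)))"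
      by (intro Bochner_Integration.integrable_diff int G C)
    show "integrable L (\<lambda>u. indicator ((G - C) \<inter> {0<..t}) u :: real)"
      by (intro integrable_real_indicator) (auto simp: emeasure_eq_measure)
    show "AE u in L. indicator (G \<inter> {..t}) u * (1 - F (t - u)) - indicator (C \<inter> {..t}) u * (1 - F (t - u))
        \<le> indicator ((G - C) \<inter> {0<..t}) u"
      using pos
    proof eventually_elim
      case (elim u)
      have "u \<in> C \<Longrightarrow> u \<le> t \<Longrightarrow> u \<in> G" using sub elim by auto
      moreover have "0 \<le> F (t - u)" by (rule F_nonneg)
      ultimately show ?case
        using elim by (cases "u \<in> C"; cases "u \<in> G"; cases "u \<le> t") simp_all
    qed
  qed
  also have "\<dots> = measure L ((G - C) \<inter> {0<..t})"
    by (simp add: borel_UNIV)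
  finally show "fluid_occupancy G t - fluid_occupancy C t \<le> measure L ((G - C) \<inter> {0<..t})" .
qed

lemma fluid_departed_Un:
  assumes [measurable]: "A \<in> sets borel" "B \<in> sets borel" and "A \<inter> B = {}"
  shows "fluid_departed (A \<union> B) t = fluid_departed A t + fluid_departed B t"
proof -
  have "fluid_departed (A \<union> B) t = (LINT u|L. indicator A u * F (t - u) + indicator B u * F (t - u))"
    unfolding fluid_departed_def using assms(3)
    by (intro Bochner_Integration.integral_cong) (auto simp: indicator_def)
  then show ?thesis
    unfolding fluid_departed_def by (simp add: integrable_departed)
qed

text \<open>
  A solution of the Volterra equation is the occupancy of a fluid system whose acceptance set \<open>G\<close>
  consists of the times at which the occupancy itself is below \<open>1\<close>. Occupancies are continuous,
  so the left limit in the equation can be dropped.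
\<close>

lemma volterra_occupancy:
  assumes leftlim: "\<And>t. t > 0 \<Longrightarrow> \<exists>l. (\<rho> \<longlongrightarrow> l) (at_left t)"
    and \<rho>0: "\<rho> 0 = 0"
    and \<rho>: "\<And>t. t \<in> {0<..H} \<Longrightarrow>
        \<rho> t = (LINT u|L. indicator {0<..t} u * (of_bool (left_lim \<rho> u < 1) * (1 - F (t - u))))"
  obtains G where "G \<in> sets borel" "\<And>u. u \<in> {0<..H} \<Longrightarrow> u \<in> G \<longleftrightarrow> fluid_occupancy G u < 1"
    "\<And>t. t \<in> {0..H} \<Longrightarrow> \<rho> t = fluid_occupancy G t"
proof -
  define G where "G = {u. 0 < u \<and> left_lim \<rho> u < 1}"
  have G: "G \<in> sets borel"
  proof -
    have "G = {u. 0 < u \<and> (if 0 < u then left_lim \<rho> u else 0) < 1}"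
      by (auto simp: G_def)
    moreover have "\<dots> \<in> sets borel"
      using left_lim_measurable[of \<rho>] leftlim by measurable
    ultimately show ?thesis by simp
  qed
  have rep: "\<rho> t = fluid_occupancy G t" if t: "t \<in> {0..H}" for t
  proof (cases "t = 0")
    case True
    have "G \<inter> {..0} = {}" by (auto simp: G_def)
    then show ?thesis
      using True \<rho>0 by (simp add: fluid_occupancy_eq_integral[OF G])
  next
    case False
    then have t: "t \<in> {0<..H}" using t by auto
    show ?thesis
      unfolding \<rho>[OF t] fluid_occupancy_eq_integral[OF G]
      by (intro Bochner_Integration.integral_cong) (auto simp: indicator_def G_def)
  qed
  have "u \<in> G \<longleftrightarrow> fluid_occupancy G u < 1" if u: "u \<in> {0<..H}" for u
  proof -
    have "(fluid_occupancy G \<longlongrightarrow> fluid_occupancy G u) (at_left u)"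
      using isCont_fluid_occupancy[OF G, of u] by (auto simp: isCont_def filterlim_at_split)
    moreover have "eventually (\<lambda>t. fluid_occupancy G t = \<rho> t) (at_left u)"
      using eventually_at_left_real[of 0 u] u by (auto elim!: eventually_mono simp: rep)
    ultimately have "(\<rho> \<longlongrightarrow> fluid_occupancy G u) (at_left u)"
      using tendsto_cong by fastforce
    then have "left_lim \<rho> u = fluid_occupancy G u" by (rule left_lim_eqI)
    then show ?thesis using u by (simp add: G_def)
  qed
  then show ?thesis using that G rep by blast
qed

end

section \<open>Comparison of sample paths\<close>

lemma finite_down_closed_eq_lessThan:
  fixes S :: "nat set"
  assumes "finite S" "\<And>i j. i \<in> S \<Longrightarrow> j \<le> i \<Longrightarrow> j \<in> S"
  shows "S = {..<card S}"
proof (cases "S = {}")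
  case False
  define m where "m = Max S"
  have m: "m \<in> S" "\<And>i. i \<in> S \<Longrightarrow> i \<le> m"
    using assms(1) False by (auto simp: m_def)
  have "S = {..<Suc m}"
    using m assms(2)[OF m(1)] by (auto simp: less_Suc_eq_le)
  then have "S = {..<Suc m} \<and> card S = Suc m" by (metis card_lessThan)
  then show ?thesis by simp
qed simp

text \<open>
  One realisation of the arrival epochs. The abbreviation \<open>x i\<close> is an epoch as a real number; it is
  only meaningful when the epoch is finite.
\<close>

locale arrival_path =
  fixes \<tau> :: "nat \<Rightarrow> ereal"
  assumes epoch_pos: "\<And>i. 0 < \<tau> i"
    and epoch_Suc: "\<And>i. if \<tau> i = \<infinity> then \<tau> (Suc i) = \<infinity> else \<tau> i < \<tau> (Suc i)"
    and locally_finite: "\<And>t. finite {i. \<tau> i \<le> ereal t}"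
begin

abbreviation x :: "nat \<Rightarrow> real" where "x i \<equiv> real_of_ereal (\<tau> i)"
definition arrived :: "real \<Rightarrow> nat" where "arrived t = card {i. \<tau> i \<le> ereal t}"

lemma epoch_mono: "i \<le> j \<Longrightarrow> \<tau> i \<le> \<tau> j"
proof (rule lift_Suc_mono_le[of \<tau>])
  show "\<tau> k \<le> \<tau> (Suc k)" for k
    using epoch_Suc[of k] by (auto split: if_splits)
qed

lemma epoch_le_iff: "\<tau> i \<le> ereal t \<longleftrightarrow> i < arrived t"
proof -
  have "{i. \<tau> i \<le> ereal t} = {..<arrived t}"
    unfolding arrived_def
  proof (rule finite_down_closed_eq_lessThan[OF locally_finite])
    fix i j assume "i \<in> {i. \<tau> i \<le> ereal t}" "j \<le> i"
    then show "j \<in> {i. \<tau> i \<le> ereal t}"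
      using order_trans[OF epoch_mono[of j i], of "ereal t"] by simp
  qed
  then show ?thesis by auto
qed

lemma epoch_eq: "\<tau> i \<noteq> \<infinity> \<Longrightarrow> \<tau> i = ereal (x i)"
  using epoch_pos[of i] by (cases "\<tau> i") auto

lemma x_pos: "\<tau> i \<noteq> \<infinity> \<Longrightarrow> 0 < x i"
  using epoch_pos[of i] by (cases "\<tau> i") auto

lemma epoch_finite: "i < arrived t \<Longrightarrow> \<tau> i \<noteq> \<infinity>"
  using epoch_le_iff[of i t] by auto

lemma less_arrived_iff: "\<tau> i \<noteq> \<infinity> \<Longrightarrow> i < arrived t \<longleftrightarrow> x i \<le> t"
  using epoch_le_iff[of i t] epoch_pos[of i] by (cases "\<tau> i") auto

lemma epoch_finite_mono: "\<tau> j \<noteq> \<infinity> \<Longrightarrow> i \<le> j \<Longrightarrow> \<tau> i \<noteq> \<infinity>"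
  using epoch_mono[of i j] by auto

lemma x_strict: "\<tau> j \<noteq> \<infinity> \<Longrightarrow> i < j \<Longrightarrow> x i < x j"
proof -
  assume j: "\<tau> j \<noteq> \<infinity>" "i < j"
  then have i: "\<tau> i \<noteq> \<infinity>" using epoch_finite_mono[of j i] by simp
  have "\<tau> i < \<tau> (Suc i)" using epoch_Suc[of i] i by simp
  also have "\<dots> \<le> \<tau> j" using j by (intro epoch_mono) simp
  finally show ?thesis
    using i j(1) epoch_pos[of i] epoch_pos[of j] by (cases "\<tau> i"; cases "\<tau> j") auto
qed

lemma arrived_mono: "t \<le> u \<Longrightarrow> arrived t \<le> arrived u"
  unfolding arrived_def
proof (intro card_mono locally_finite subsetI)
  fix i assume "t \<le> u" "i \<in> {i. \<tau> i \<le> ereal t}"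
  then show "i \<in> {i. \<tau> i \<le> ereal u}"
    using order_trans[of "\<tau> i" "ereal t" "ereal u"] by simp
qed

lemma arrived_nonpos: "t \<le> 0 \<Longrightarrow> arrived t = 0"
  using epoch_pos[of 0] epoch_le_iff[of 0 t] by (cases "\<tau> 0") auto

lemma arrived_epoch: "\<tau> j \<noteq> \<infinity> \<Longrightarrow> i < arrived (x j) \<longleftrightarrow> i \<le> j"
proof -
  assume j: "\<tau> j \<noteq> \<infinity>"
  show "i < arrived (x j) \<longleftrightarrow> i \<le> j"
  proof
    show "i \<le> j" if "i < arrived (x j)"
    proof (rule ccontr)
      assume "\<not> i \<le> j"
      then have "x j < x i" using x_strict[of i j] epoch_finite[OF that] by simp
      then show False using less_arrived_iff[OF epoch_finite[OF that], of "x j"] that by simp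
    qed
    show "i < arrived (x j)" if "i \<le> j"
      using less_arrived_iff[of j "x j"] j that by simp
  qed
qed

lemma eventually_arrived_before_epoch:
  assumes "\<tau> i \<noteq> \<infinity>"
  shows "eventually (\<lambda>u. 0 \<le> u \<and> u < x i \<and> arrived u = i) (at_left (x i))"
proof -
  define b where "b = (if i = 0 then 0 else x (i - 1))"
  have b: "0 \<le> b" "b < x i"
    using x_pos[OF assms] x_strict[OF assms, of "i - 1"] x_pos[OF epoch_finite_mono[OF assms, of "i - 1"]]
    by (auto simp: b_def)
  from eventually_at_left_real[OF b(2)] show ?thesis
  proof eventually_elim
    case (elim u)
    have "\<not> i < arrived u"
      using elim less_arrived_iff[OF assms, of u] by auto
    moreover have "i - 1 < arrived u" if "i \<noteq> 0"
      using elim that less_arrived_iff[OF epoch_finite_mono[OF assms, of "i - 1"], of u] by (auto simp: b_def)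
    ultimately show ?case using elim b by force
  qed
qed

end

text \<open>
  One realisation of the \<open>n\<close>-th loss system. The number \<open>in_service c t\<close> is hypothetical in general:
  it is the occupancy at time \<open>t\<close> of a system without blocking in which exactly the arrivals in \<open>c\<close>
  are accepted. The loss system itself is the case \<open>c = admitted\<close>.
\<close>

locale loss_path = arrival_path \<tau> for \<tau> :: "nat \<Rightarrow> ereal" +
  fixes n :: nat and s :: "nat \<Rightarrow> real" and r :: "real \<Rightarrow> real"
  assumes n_pos: "n \<ge> 1"
    and occupied: "\<And>t. t \<ge> 0 \<Longrightarrow> r t = 1 / real n *
         (\<Sum>i. of_bool (left_lim r (real_of_ereal (\<tau> i)) < 1)
              * of_bool (ereal (s i) > ereal t - \<tau> i)
              * of_bool (\<tau> i \<le> ereal t))"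
begin

definition admitted :: "nat \<Rightarrow> bool" where
  "admitted i \<longleftrightarrow> left_lim r (x i) < 1"

definition busy :: "nat \<Rightarrow> nat" where
  "busy i = card {j. j < i \<and> admitted j \<and> x i - x j \<le> s j}"

definition in_service :: "(nat \<Rightarrow> bool) \<Rightarrow> real \<Rightarrow> nat" where
  "in_service c t = card {i. i < arrived t \<and> c i \<and> t - x i < s i}"

lemma in_service_eq_sum: "real (in_service c t) = (\<Sum>i<arrived t. of_bool (c i) * of_bool (t - x i < s i))"
proof -
  have "(\<Sum>i<arrived t. of_bool (c i) * of_bool (t - x i < s i)) = (\<Sum>i<arrived t. of_bool (c i \<and> t - x i < s i) :: real)"
    by (intro sum.cong) auto
  also have "\<dots> = real (card ({..<arrived t} \<inter> {i. c i \<and> t - x i < s i}))"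
    by (simp add: of_bool_def sum.If_cases)
  also have "{..<arrived t} \<inter> {i. c i \<and> t - x i < s i} = {i. i < arrived t \<and> c i \<and> t - x i < s i}"
    by auto
  finally show ?thesis by (simp add: in_service_def)
qed

lemma occupied_eq_in_service:
  assumes t: "t \<ge> 0"
  shows "r t = real (in_service admitted t) / real n"
proof -
  have "(\<Sum>i. of_bool (left_lim r (x i) < 1) * of_bool (ereal (s i) > ereal t - \<tau> i) * of_bool (\<tau> i \<le> ereal t) :: real)
      = (\<Sum>i<arrived t. of_bool (left_lim r (x i) < 1) * of_bool (ereal (s i) > ereal t - \<tau> i) * of_bool (\<tau> i \<le> ereal t))"
    by (intro suminf_finite) (auto simp: epoch_le_iff)
  also have "\<dots> = (\<Sum>i<arrived t. of_bool (admitted i) * of_bool (t - x i < s i))"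
  proof (intro sum.cong refl)
    fix i assume i: "i \<in> {..<arrived t}"
    then have "\<tau> i = ereal (x i)" using epoch_finite epoch_eq by auto
    then have "ereal t - \<tau> i = ereal (t - x i)" by (cases "\<tau> i") auto
    then show "of_bool (left_lim r (x i) < 1) * of_bool (ereal (s i) > ereal t - \<tau> i) * of_bool (\<tau> i \<le> ereal t)
        = (of_bool (admitted i) * of_bool (t - x i < s i) :: real)"
      using i by (simp add: epoch_le_iff admitted_def)
  qed
  finally show ?thesis using occupied[OF t] by (simp add: in_service_eq_sum)
qed

text \<open>
  Just before an epoch no arrival and no departure interferes, so the left limit exists there. A
  service ending exactly at the epoch still counts as running, which is why \<open>busy\<close> is defined
  with a non-strict inequality.
\<close>

lemma occupied_before_epoch:
  assumes "\<tau> i \<noteq> \<infinity>"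
  shows "eventually (\<lambda>u. r u = real (busy i) / real n) (at_left (x i))"
    and "admitted i \<longleftrightarrow> busy i < n"
proof -
  have "eventually (\<lambda>u. \<forall>j\<in>{..<i}. u - x j < s j \<longleftrightarrow> x i - x j \<le> s j) (at_left (x i))"
  proof (intro eventually_ball_finite ballI)
    fix j assume "j \<in> {..<i}"
    show "eventually (\<lambda>u. u - x j < s j \<longleftrightarrow> x i - x j \<le> s j) (at_left (x i))"
    proof (cases "x i - x j \<le> s j")
      case True
      then show ?thesis
        using eventually_arrived_before_epoch[OF assms] by (auto elim!: eventually_mono)
    next
      case False
      then have "x j + s j < x i" by simp
      from eventually_at_left_real[OF this] show ?thesis
        using False by (auto elim!: eventually_mono)
    qed
  qed auto
  with eventually_arrived_before_epoch[OF assms]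
  show ev: "eventually (\<lambda>u. r u = real (busy i) / real n) (at_left (x i))"
  proof eventually_elim
    case (elim u)
    then have "{j. j < arrived u \<and> admitted j \<and> u - x j < s j} = {j. j < i \<and> admitted j \<and> x i - x j \<le> s j}"
      by auto
    then show ?case
      using occupied_eq_in_service[of u] elim by (simp add: in_service_def busy_def)
  qed
  then have "left_lim r (x i) = real (busy i) / real n"
    by (intro left_lim_eqI tendsto_eventually)
  then show "admitted i \<longleftrightarrow> busy i < n"
    using n_pos by (simp add: admitted_def)
qed

lemma in_service_le_busy:
  assumes "arrived t = Suc i"
  shows "in_service admitted t \<le> busy i + of_bool (admitted i)"
proof -
  have i: "\<tau> i \<noteq> \<infinity>" "x i \<le> t"
    using epoch_finite[of i t] less_arrived_iff[of i t] assms by auto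
  have "{j. j < arrived t \<and> admitted j \<and> t - x j < s j}
      \<subseteq> {j. j < i \<and> admitted j \<and> x i - x j \<le> s j} \<union> (if admitted i then {i} else {})"
    using i(2) by (auto simp: assms less_Suc_eq)
  then have "in_service admitted t \<le> card ({j. j < i \<and> admitted j \<and> x i - x j \<le> s j} \<union> (if admitted i then {i} else {}))"
    unfolding in_service_def by (intro card_mono) auto
  also have "\<dots> \<le> busy i + of_bool (admitted i)"
    unfolding busy_def by (rule order_trans[OF card_Un_le]) auto
  finally show ?thesis .
qed

text \<open>
  No more than \<open>n\<close> servers are ever occupied: between consecutive arrivals their number only
  decreases, and an admitted arrival finds at most \<open>n - 1\<close> of them busy.
\<close>

lemma busy_le: "\<tau> i \<noteq> \<infinity> \<Longrightarrow> busy i \<le> n"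
proof (induction i)
  case (Suc i)
  have fin: "\<tau> i \<noteq> \<infinity>" using epoch_finite_mono[OF Suc.prems, of i] by simp
  have "x i < x (Suc i)" by (rule x_strict[OF Suc.prems]) simp
  then have "{j. j < Suc i \<and> admitted j \<and> x (Suc i) - x j \<le> s j}
      \<subseteq> {j. j < i \<and> admitted j \<and> x i - x j \<le> s j} \<union> (if admitted i then {i} else {})"
    by (auto simp: less_Suc_eq)
  then have "busy (Suc i) \<le> card ({j. j < i \<and> admitted j \<and> x i - x j \<le> s j} \<union> (if admitted i then {i} else {}))"
    unfolding busy_def by (intro card_mono) auto
  also have "\<dots> \<le> busy i + of_bool (admitted i)"
    unfolding busy_def by (rule order_trans[OF card_Un_le]) auto
  finally show ?case
    using Suc.IH[OF fin] occupied_before_epoch(2)[OF fin] by (cases "admitted i") auto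
qed (simp add: busy_def)

lemma in_service_le:
  "in_service admitted t \<le> n"
proof (cases "arrived t")
  case 0
  then show ?thesis by (simp add: in_service_def)
next
  case (Suc i)
  then have "\<tau> i \<noteq> \<infinity>" using epoch_finite[of i t] by auto
  then show ?thesis
    using in_service_le_busy[OF Suc] busy_le[of i] occupied_before_epoch(2)[of i] by (cases "admitted i") auto
qed

lemma in_service_decreasing:
  assumes "u \<le> t" and "\<And>i. i < arrived t \<Longrightarrow> c i \<Longrightarrow> i < arrived u"
  shows "in_service c t \<le> in_service c u"
  unfolding in_service_def using assms by (intro card_mono) auto

lemma in_service_diff:
  "real (in_service admitted t) - real (in_service c t)
   = real (in_service (\<lambda>i. admitted i \<and> \<not> c i) t) - real (in_service (\<lambda>i. \<not> admitted i \<and> c i) t)"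
  unfolding in_service_eq_sum sum_subtractf[symmetric] by (intro sum.cong) auto

text \<open>
  The heart of the proof: a comparison of the loss system with an ideal system that accepts exactly
  the arrivals in \<open>c\<close>. Let \<open>P\<close> count the customers in service that are admitted but not in \<open>c\<close>,
  and \<open>Q\<close> those that are in \<open>c\<close> and would still be in service, but were blocked. The two systems
  differ by \<open>P - Q\<close>, and \<open>P\<close> and \<open>Q\<close> grow in opposite situations.
  An arrival outside \<open>c\<close> comes when the ideal system is nearly full (\<open>full\<close>), and since the loss
  system never holds more than \<open>n\<close> customers, \<open>P - Q \<le> n * \<theta>\<close> right after it. An arrival in \<open>c\<close>
  that is blocked finds the loss system full while the ideal system has room to spare (\<open>slack\<close>), so
  that \<open>P - Q \<ge> n * \<theta> + 1\<close> right before it, unless it is one of the exceptional arrivals \<open>w\<close>.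

  From the last admitted arrival of the first kind up to a blocked arrival of the second kind, \<open>P\<close>
  can only have decreased while \<open>P - Q\<close> has increased by at least \<open>1\<close>. So \<open>Q\<close> has decreased by at
  least \<open>1\<close>, which makes up for the new blocked customer. Therefore \<open>Q\<close> never
  exceeds the number of exceptional arrivals, however often the two situations alternate.
\<close>

lemma occupied_near_ideal:
  assumes \<theta>: "\<theta> \<ge> 0"
    and full: "\<And>j. j < arrived H \<Longrightarrow> \<not> c j \<Longrightarrow> real n * (1 - \<theta>) \<le> real (in_service c (x j))"
    and slack: "\<And>i. i < arrived H \<Longrightarrow> c i \<Longrightarrow> \<not> w i \<Longrightarrow>
      eventually (\<lambda>u. real (in_service c u) + 1 \<le> real n * (1 - \<theta>)) (at_left (x i))"
    and t: "t \<in> {0..H}"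
  shows "\<bar>real n * r t - real (in_service c t)\<bar> \<le> real n * \<theta> + real (card {i. i < arrived H \<and> w i})"
proof -
  define P where "P = in_service (\<lambda>i. admitted i \<and> \<not> c i)"
  define Q where "Q = in_service (\<lambda>i. \<not> admitted i \<and> c i)"
  define W where "W m = card {i. i < m \<and> w i}" for m
  have diff: "real (in_service admitted t) - real (in_service c t) = real (P t) - real (Q t)" for t
    unfolding P_def Q_def by (rule in_service_diff)
  have after: "real (P (x j)) - real (Q (x j)) \<le> real n * \<theta>" if j: "j < arrived H" "\<not> c j" for j
    using full[OF j] in_service_le[of "x j"] diff[of "x j"] by (simp add: algebra_simps)
  have last_P: "\<exists>j<arrived u. \<not> c j \<and> x j \<le> u \<and> P u \<le> P (x j)" if "P u \<noteq> 0" for u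
  proof -
    define S where "S = {j. j < arrived u \<and> admitted j \<and> \<not> c j}"
    have S: "finite S" by (simp add: S_def)
    have "S \<noteq> {}"
    proof
      assume "S = {}"
      then have "{i. i < arrived u \<and> (admitted i \<and> \<not> c i) \<and> u - x i < s i} = {}"
        by (auto simp: S_def)
      then show False using that by (simp add: P_def in_service_def)
    qed
    define j where "j = Max S"
    have j: "j < arrived u" "\<not> c j" "\<And>i. i \<in> S \<Longrightarrow> i \<le> j"
      using Max_in[OF S \<open>S \<noteq> {}\<close>] Max_ge[OF S] by (auto simp: j_def S_def)
    have fin: "\<tau> j \<noteq> \<infinity>" by (rule epoch_finite[OF j(1)])
    have xj: "x j \<le> u" using less_arrived_iff[OF fin] j(1) by simp
    have "P u \<le> P (x j)"
      unfolding P_def using xj j(3) by (intro in_service_decreasing) (auto simp: arrived_epoch[OF fin] S_def)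
    then show ?thesis using j xj by blast
  qed
  \<comment> \<open>Induction over the number of arrivals, since the last arrivals of either kind lie strictly in the past.\<close>
  have Q_le: "Q t \<le> W (arrived t)" if "t \<le> H" for t
    using that
  proof (induction "arrived t" arbitrary: t rule: less_induct)
    case (less t)
    define S where "S = {i. i < arrived t \<and> \<not> admitted i \<and> c i \<and> \<not> w i}"
    have S: "finite S" by (simp add: S_def)
    show ?case
    proof (cases "S = {}")
      case True
      then show ?thesis
        unfolding Q_def W_def in_service_def by (intro card_mono) (auto simp: S_def)
    next
      case False
      define i where "i = Max S"
      have i: "i < arrived t" "\<not> admitted i" "c i" "\<not> w i" "\<And>k. k \<in> S \<Longrightarrow> k \<le> i"
        using Max_in[OF S False] Max_ge[OF S] by (auto simp: i_def S_def)
      have iH: "i < arrived H" using i(1) arrived_mono[OF less.prems] by simp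
      have fin: "\<tau> i \<noteq> \<infinity>" by (rule epoch_finite[OF i(1)])
      have xi: "x i \<le> t" using less_arrived_iff[OF fin] i(1) by simp
      have "eventually (\<lambda>u. ((0 \<le> u \<and> u < x i \<and> arrived u = i) \<and> r u = real (busy i) / real n)
          \<and> real (in_service c u) + 1 \<le> real n * (1 - \<theta>)) (at_left (x i))"
        by (intro eventually_conj eventually_arrived_before_epoch[OF fin] occupied_before_epoch(1)[OF fin] slack[OF iH i(3,4)])
      \<comment> \<open>A time just before the blocked arrival \<open>i\<close>; the left limit itself need not be attained.\<close>
      then obtain u where u: "0 \<le> u" "u < x i" "arrived u = i" "r u = real (busy i) / real n"
        "real (in_service c u) + 1 \<le> real n * (1 - \<theta>)"
        using eventually_happens'[OF trivial_limit_at_left_real] by blast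
      have "busy i = n"
        using busy_le[OF fin] occupied_before_epoch(2)[OF fin] i(2) by simp
      then have "real (in_service admitted u) = real n"
        using u occupied_eq_in_service[OF u(1)] n_pos by simp
      then have gap: "real n * \<theta> + 1 + real (Q u) \<le> real (P u)"
        using diff[of u] u(5) by (simp add: algebra_simps)
      have nonneg: "0 \<le> real n * \<theta>" using \<theta> by simp
      then have "P u \<noteq> 0" using gap by auto
      then obtain j where j: "j < arrived u" "\<not> c j" "x j \<le> u" "P u \<le> P (x j)"
        using last_P by blast
      have jfin: "\<tau> j \<noteq> \<infinity>" by (rule epoch_finite[OF j(1)])
      have aj: "arrived (x j) = Suc j"
        using arrived_epoch[OF jfin] by (metis lessI less_Suc_eq_le not_less_eq linorder_neqE_nat less_irrefl)
      have "real (P (x j)) - real (Q (x j)) \<le> real n * \<theta>"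
        using j u iH by (intro after) auto
      then have "Q u + 1 \<le> Q (x j)" using gap j(4) by linarith
      also have "Q (x j) \<le> W (arrived (x j))"
        using less.hyps[of "x j"] aj j u i(1) xi less.prems by simp
      also have "\<dots> \<le> W i"
        unfolding aj W_def using j u by (intro card_mono) auto
      finally have Qu: "Q u + 1 \<le> W i" .
      have sub: "{k. k < arrived t \<and> (\<not> admitted k \<and> c k) \<and> t - x k < s k}
          \<subseteq> {k. k < arrived u \<and> (\<not> admitted k \<and> c k) \<and> u - x k < s k} \<union> {i} \<union> {k. i < k \<and> k < arrived t \<and> w k}"
      proof
        fix k assume k: "k \<in> {k. k < arrived t \<and> (\<not> admitted k \<and> c k) \<and> t - x k < s k}"
        show "k \<in> {k. k < arrived u \<and> (\<not> admitted k \<and> c k) \<and> u - x k < s k} \<union> {i} \<union> {k. i < k \<and> k < arrived t \<and> w k}"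
          using k i(5)[of k] u xi by (cases k i rule: linorder_cases) (auto simp: S_def)
      qed
      have "Q t \<le> card ({k. k < arrived u \<and> (\<not> admitted k \<and> c k) \<and> u - x k < s k} \<union> {i} \<union> {k. i < k \<and> k < arrived t \<and> w k})"
        unfolding Q_def in_service_def by (intro card_mono sub) auto
      also have "\<dots> \<le> Q u + 1 + card {k. i < k \<and> k < arrived t \<and> w k}"
        unfolding Q_def in_service_def
        by (intro order_trans[OF card_Un_le] add_mono order_refl) auto
      also have "\<dots> \<le> W i + card {k. i < k \<and> k < arrived t \<and> w k}"
        using Qu by simp
      also have "\<dots> = card ({k. k < i \<and> w k} \<union> {k. i < k \<and> k < arrived t \<and> w k})"
        unfolding W_def by (intro card_Un_disjoint[symmetric]) auto
      also have "\<dots> \<le> W (arrived t)"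
        unfolding W_def using i(1) by (intro card_mono) auto
      finally show ?thesis .
    qed
  qed
  have W_le: "W (arrived u) \<le> W (arrived H)" if "u \<le> H" for u
    unfolding W_def using arrived_mono[OF that] by (intro card_mono) auto
  have P_le: "real (P t) \<le> real n * \<theta> + real (W (arrived H))"
  proof (cases "P t = 0")
    case True
    then show ?thesis using \<theta> by simp
  next
    case False
    then obtain j where j: "j < arrived t" "\<not> c j" "x j \<le> t" "P t \<le> P (x j)"
      using last_P by blast
    have "Q (x j) \<le> W (arrived H)"
      using Q_le[of "x j"] W_le[of "x j"] j t by simp
    moreover have "real (P (x j)) - real (Q (x j)) \<le> real n * \<theta>"
      using j t arrived_mono[of t H] by (intro after) auto
    ultimately show ?thesis using j(4) by linarith
  qed
  have "real (Q t) \<le> real (W (arrived H))"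
    using Q_le[of t] W_le[of t] t by simp
  moreover have "real n * r t = real (in_service admitted t)"
    using occupied_eq_in_service[of t] t n_pos by simp
  moreover have "0 \<le> real n * \<theta>" using \<theta> by simp
  ultimately show ?thesis
    using diff[of t] P_le unfolding W_def by (simp add: abs_le_iff)
qed

end

section \<open>Laws of large numbers on one outcome\<close>

text \<open>
  Partial sums of nonnegative terms are monotone in the number of terms, so the number of terms
  matters only asymptotically. It will be the number of arrivals up to some time, which may depend
  on the terms.
\<close>

lemma random_index_sum_limit:
  fixes f :: "nat \<Rightarrow> nat \<Rightarrow> real" and m :: "nat \<Rightarrow> nat"
  assumes nonneg: "\<And>n i. 0 \<le> f n i"
    and sums: "\<And>y. y \<in> \<rat> \<Longrightarrow> 0 \<le> y \<Longrightarrow> (\<lambda>n. (\<Sum>i<nat \<lfloor>y * real n\<rfloor>. f n i) / real n) \<longlonglongrightarrow> y * c"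
    and m: "(\<lambda>n. real (m n) / real n) \<longlonglongrightarrow> y0"
    and c: "0 \<le> c"
  shows "(\<lambda>n. (\<Sum>i<m n. f n i) / real n) \<longlonglongrightarrow> y0 * c"
proof (rule order_tendstoI)
  have y0: "0 \<le> y0"
    by (rule tendsto_lowerbound[OF m]) auto
  have mono: "(\<Sum>i<j. f n i) / real n \<le> (\<Sum>i<k. f n i) / real n" if "j \<le> k" for j k n
    using that nonneg by (intro divide_right_mono sum_mono2) auto
  fix a :: real
  show "eventually (\<lambda>n. a < (\<Sum>i<m n. f n i) / real n) sequentially" if a: "a < y0 * c"
  proof (cases "a < 0")
    case True
    have "0 \<le> (\<Sum>i<m n. f n i) / real n" for n
      using nonneg by (intro divide_nonneg_nonneg sum_nonneg) auto
    then show ?thesis using True by (intro always_eventually) (meson less_le_trans)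
  next
    case False
    then have pos: "c > 0" using a c y0 by (cases "c = 0") auto
    then obtain y where y: "y \<in> \<rat>" "a / c < y" "y < y0"
      using Rats_dense_in_real[of "a / c" y0] a by (auto simp: field_simps)
    have "0 \<le> a / c" using False pos by simp
    then have y_pos: "0 \<le> y" using y(2) by linarith
    have "eventually (\<lambda>n. a < (\<Sum>i<nat \<lfloor>y * real n\<rfloor>. f n i) / real n) sequentially"
      using sums[OF y(1) y_pos] y(2) pos by (intro order_tendstoD) (auto simp: field_simps)
    moreover have "eventually (\<lambda>n. y < real (m n) / real n) sequentially"
      using m y(3) by (rule order_tendstoD)
    ultimately show ?thesis
      using eventually_gt_at_top[of 0]
    proof eventually_elim
      case (elim n)
      then have "y * real n < real (m n)" by (simp add: field_simps)
      then have "nat \<lfloor>y * real n\<rfloor> \<le> m n" by linarith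
      from mono[OF this, of n] elim(1) show ?case by linarith
    qed
  qed
  show "eventually (\<lambda>n. (\<Sum>i<m n. f n i) / real n < a) sequentially" if a: "y0 * c < a"
  proof -
    obtain y where y: "y \<in> \<rat>" "y0 < y" "y * c < a"
    proof (cases "c = 0")
      case True
      then show ?thesis
        using that Rats_dense_in_real[of y0 "y0 + 1"] a by auto
    next
      case False
      then have "c > 0" using c by simp
      then show ?thesis
        using that Rats_dense_in_real[of y0 "a / c"] a by (auto simp: field_simps)
    qed
    have "eventually (\<lambda>n. (\<Sum>i<nat \<lfloor>y * real n\<rfloor>. f n i) / real n < a) sequentially"
      using y y0 by (intro order_tendstoD[OF sums]) auto
    moreover have "eventually (\<lambda>n. real (m n) / real n < y) sequentially"
      using m y(2) by (rule order_tendstoD)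
    ultimately show ?thesis
      using eventually_gt_at_top[of 0]
    proof eventually_elim
      case (elim n)
      then have "real (m n) < y * real n" by (simp add: field_simps)
      then have "m n \<le> nat \<lfloor>y * real n\<rfloor>" by linarith
      from mono[OF this, of n] elim(1) show ?case by linarith
    qed
  qed
qed

text \<open>
  A fixed outcome, for the whole sequence of systems, on which the two laws of large numbers hold
  at rational arguments.
\<close>

locale loss_sequence = fluid_input L F for L :: "real measure" and F :: "real \<Rightarrow> real" +
  fixes \<tau> :: "nat \<Rightarrow> nat \<Rightarrow> ereal" and s :: "nat \<Rightarrow> nat \<Rightarrow> real" and r :: "nat \<Rightarrow> real \<Rightarrow> real" and H :: real
  assumes path: "\<And>n. n \<ge> 1 \<Longrightarrow> loss_path (\<tau> n) n (s n) (r n)"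
    and arrivals: "\<And>q. q \<in> \<rat> \<Longrightarrow> 0 \<le> q \<Longrightarrow> q \<le> H + 1 \<Longrightarrow>
      (\<lambda>n. real (arrival_path.arrived (\<tau> n) q) / real n) \<longlonglongrightarrow> cdf L q"
    and services: "\<And>x y. x \<in> \<rat> \<Longrightarrow> y \<in> \<rat> \<Longrightarrow> 0 \<le> y \<Longrightarrow>
      (\<lambda>n. (\<Sum>i<nat \<lfloor>y * real n\<rfloor>. of_bool (s n i \<le> x)) / real n) \<longlonglongrightarrow> y * F x"
begin

abbreviation epoch :: "nat \<Rightarrow> nat \<Rightarrow> real" where "epoch n i \<equiv> real_of_ereal (\<tau> n i)"
abbreviation arrivals_upto :: "nat \<Rightarrow> real \<Rightarrow> nat" where
  "arrivals_upto n t \<equiv> arrival_path.arrived (\<tau> n) t"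

definition arrived_in :: "real set \<Rightarrow> nat \<Rightarrow> real \<Rightarrow> real" where
  "arrived_in G n t = (\<Sum>i<arrivals_upto n t. indicator G (epoch n i)) / real n"

definition departed_in :: "real set \<Rightarrow> nat \<Rightarrow> real \<Rightarrow> real" where
  "departed_in G n t = (\<Sum>i<arrivals_upto n t. indicator G (epoch n i) * of_bool (s n i \<le> t - epoch n i)) / real n"

definition short_services :: "nat \<Rightarrow> real \<Rightarrow> real \<Rightarrow> real" where
  "short_services n p x = (\<Sum>i<arrivals_upto n p. of_bool (s n i \<le> x)) / real n"

text \<open>
  \<open>G\<close> is typical if the arrivals with epochs in \<open>G\<close> follow the fluid model, uniformly over
  \<open>[0, H]\<close>. This can fail for open \<open>G\<close>, as the epochs may well avoid the boundary
  even when it carries mass; it is proved for finite unions of intervals with rational endpoints.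
\<close>

definition typical :: "real set \<Rightarrow> bool" where
  "typical G \<longleftrightarrow> G \<in> sets borel \<and> (\<forall>\<epsilon>>0. eventually (\<lambda>n. \<forall>t\<in>{0..H}.
     \<bar>arrived_in G n t - measure L (G \<inter> {..t})\<bar> \<le> \<epsilon> \<and> \<bar>departed_in G n t - fluid_departed G t\<bar> \<le> \<epsilon>) sequentially)"

lemma path_facts:
  assumes "n \<ge> 1"
  shows arrivals_mono: "t \<le> u \<Longrightarrow> arrivals_upto n t \<le> arrivals_upto n u"
    and epoch_positive: "i < arrivals_upto n t \<Longrightarrow> 0 < epoch n i"
    and arrivals_iff: "i < arrivals_upto n t \<Longrightarrow> i < arrivals_upto n u \<longleftrightarrow> epoch n i \<le> u"
proof -
  interpret loss_path "\<tau> n" n "s n" "r n" by (rule path[OF assms])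
  show "t \<le> u \<Longrightarrow> arrivals_upto n t \<le> arrivals_upto n u" by (rule arrived_mono)
  show "i < arrivals_upto n t \<Longrightarrow> 0 < epoch n i" using x_pos epoch_finite by blast
  show "i < arrivals_upto n t \<Longrightarrow> i < arrivals_upto n u \<longleftrightarrow> epoch n i \<le> u"
    using less_arrived_iff epoch_finite by blast
qed

lemma arrivals_min_iff:
  assumes n: "n \<ge> 1"
  shows "i < arrivals_upto n (min p t) \<longleftrightarrow> i < arrivals_upto n t \<and> epoch n i \<le> p"
proof (cases "i < arrivals_upto n t")
  case True
  then show ?thesis
    using arrivals_iff[OF n True, of "min p t"] arrivals_iff[OF n True, of t] by simp
next
  case False
  then show ?thesis
    using arrivals_mono[OF n, of "min p t" t] by simp
qed

lemma arrived_in_mono: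
  assumes "n \<ge> 1"
  shows "mono (arrived_in G n)"
  unfolding arrived_in_def
  by (intro monoI divide_right_mono sum_mono2) (use arrivals_mono[OF assms] in auto)

lemma departed_in_mono:
  assumes "n \<ge> 1"
  shows "mono (departed_in G n)"
proof (rule monoI)
  fix t u :: real assume tu: "t \<le> u"
  have "(\<Sum>i<arrivals_upto n t. indicator G (epoch n i) * of_bool (s n i \<le> t - epoch n i) :: real)
      \<le> (\<Sum>i<arrivals_upto n t. indicator G (epoch n i) * of_bool (s n i \<le> u - epoch n i))"
    using tu by (intro sum_mono mult_left_mono) auto
  also have "\<dots> \<le> (\<Sum>i<arrivals_upto n u. indicator G (epoch n i) * of_bool (s n i \<le> u - epoch n i))"
    using arrivals_mono[OF assms tu] by (intro sum_mono2) auto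
  finally show "departed_in G n t \<le> departed_in G n u"
    unfolding departed_in_def by (rule divide_right_mono) simp
qed

lemma short_services_limit:
  assumes "p \<in> \<rat>" "0 \<le> p" "p \<le> H + 1" "x \<in> \<rat>"
  shows "(\<lambda>n. short_services n p x) \<longlonglongrightarrow> cdf L p * F x"
  unfolding short_services_def
proof (rule random_index_sum_limit[OF _ _ arrivals[OF assms(1-3)] F_nonneg])
  show "(\<lambda>n. (\<Sum>i<nat \<lfloor>y * real n\<rfloor>. of_bool (s n i \<le> x)) / real n) \<longlonglongrightarrow> y * F x"
    if "y \<in> \<rat>" "0 \<le> y" for y
    using services[OF assms(4) that] .
qed simp

lemma sum_prefix:
  fixes g :: "nat \<Rightarrow> real"
  assumes n: "n \<ge> 1"
  shows "(\<Sum>i<arrivals_upto n t. indicator {0<..p} (epoch n i) * g i) = (\<Sum>i<arrivals_upto n (min p t). g i)"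
proof -
  have "{..<arrivals_upto n (min p t)} = {i \<in> {..<arrivals_upto n t}. epoch n i \<le> p}"
    by (intro set_eqI) (simp add: arrivals_min_iff[OF n])
  then have "(\<Sum>i<arrivals_upto n (min p t). g i) = (\<Sum>i<arrivals_upto n t. if epoch n i \<le> p then g i else 0)"
    by (simp only: sum.inter_filter[OF finite_lessThan])
  also have "\<dots> = (\<Sum>i<arrivals_upto n t. indicator {0<..p} (epoch n i) * g i)"
  proof (intro sum.cong refl)
    fix i assume "i \<in> {..<arrivals_upto n t}"
    then have "0 < epoch n i" using epoch_positive[OF n, of i t] by simp
    then show "(if epoch n i \<le> p then g i else 0) = indicator {0<..p} (epoch n i) * g i"
      by simp
  qed
  finally show ?thesis by simp
qed

lemma arrived_in_prefix:
  assumes n: "n \<ge> 1"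
  shows "arrived_in {0<..p} n t = real (arrivals_upto n (min p t)) / real n"
  using sum_prefix[OF n, where g = "\<lambda>_. 1"] by (simp add: arrived_in_def)

lemma departed_in_prefix:
  assumes n: "n \<ge> 1"
  shows "departed_in {0<..p} n t = (\<Sum>i<arrivals_upto n (min p t). of_bool (s n i \<le> t - epoch n i)) / real n"
  unfolding departed_in_def sum_prefix[OF n] ..

text \<open>
  A customer arriving in \<open>(p, p']\<close> has left by time \<open>q\<close> if its service is at most \<open>q - p'\<close>, and only
  if it is at most \<open>q - p\<close>. These bounds see the epochs only through the counts at \<open>p\<close> and
  \<open>p'\<close>.
\<close>

lemma departed_in_prefix_increment:
  assumes n: "n \<ge> 1" and p: "p \<le> p'" "p' \<le> q"
  shows "departed_in {0<..p'} n q - departed_in {0<..p} n q \<le> short_services n p' (q - p) - short_services n p (q - p)"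
    and "short_services n p' (q - p') - short_services n p (q - p') \<le> departed_in {0<..p'} n q - departed_in {0<..p} n q"
proof -
  have le: "arrivals_upto n p \<le> arrivals_upto n p'" by (rule arrivals_mono[OF n p(1)])
  have split: "(\<Sum>i<arrivals_upto n p'. g i) - (\<Sum>i<arrivals_upto n p. g i)
      = (\<Sum>i\<in>{arrivals_upto n p..<arrivals_upto n p'}. g i)" for g :: "nat \<Rightarrow> real"
  proof -
    have "(\<Sum>i<arrivals_upto n p'. g i) = (\<Sum>i\<in>{..<arrivals_upto n p} \<union> {arrivals_upto n p..<arrivals_upto n p'}. g i)"
      using le by (intro sum.cong) auto
    also have "\<dots> = (\<Sum>i<arrivals_upto n p. g i) + (\<Sum>i\<in>{arrivals_upto n p..<arrivals_upto n p'}. g i)"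
      by (intro sum.union_disjoint) auto
    finally show ?thesis by simp
  qed
  have between: "p < epoch n i" "epoch n i \<le> p'" if "i \<in> {arrivals_upto n p..<arrivals_upto n p'}" for i
  proof -
    have i: "i < arrivals_upto n p'" "\<not> i < arrivals_upto n p" using that by auto
    show "p < epoch n i" using arrivals_iff[OF n i(1), of p] i(2) by simp
    show "epoch n i \<le> p'" using arrivals_iff[OF n i(1), of p'] i(1) by simp
  qed
  have pq: "min p q = p" "min p' q = p'" using p by auto
  show "departed_in {0<..p'} n q - departed_in {0<..p} n q \<le> short_services n p' (q - p) - short_services n p (q - p)"
    unfolding departed_in_prefix[OF n] pq short_services_def diff_divide_distrib[symmetric] split
  proof (intro divide_right_mono sum_mono)
    fix i assume "i \<in> {arrivals_upto n p..<arrivals_upto n p'}"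
    from between[OF this] show "(of_bool (s n i \<le> q - epoch n i) :: real) \<le> of_bool (s n i \<le> q - p)" by auto
  qed simp
  show "short_services n p' (q - p') - short_services n p (q - p') \<le> departed_in {0<..p'} n q - departed_in {0<..p} n q"
    unfolding departed_in_prefix[OF n] pq short_services_def diff_divide_distrib[symmetric] split
  proof (intro divide_right_mono sum_mono)
    fix i assume "i \<in> {arrivals_upto n p..<arrivals_upto n p'}"
    from between[OF this] show "(of_bool (s n i \<le> q - p') :: real) \<le> of_bool (s n i \<le> q - epoch n i)" by auto
  qed simp
qed

lemma fluid_departed_prefix_increment:
  assumes p: "0 \<le> p" "p \<le> p'"
  shows "fluid_departed {0<..p'} q - fluid_departed {0<..p} q \<le> (cdf L p' - cdf L p) * F (q - p)"
    and "(cdf L p' - cdf L p) * F (q - p') \<le> fluid_departed {0<..p'} q - fluid_departed {0<..p} q"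
proof -
  have un: "{0<..p'} = {0<..p} \<union> {p<..p'}" using p by auto
  have "fluid_departed {0<..p'} q = fluid_departed {0<..p} q + fluid_departed {p<..p'} q"
    by (subst un, rule fluid_departed_Un) auto
  moreover have cdf: "cdf L p' - cdf L p = measure L {p<..p'}"
    using cdf_diff_eq[of p p'] p by (cases "p = p'") auto
  have const: "(LINT u|L. indicator {p<..p'} u * c) = measure L {p<..p'} * c" for c :: real
    by (simp add: borel_UNIV)
  have int: "integrable L (\<lambda>u. indicator {p<..p'} u * c)" for c :: real
    by (intro integrable_mult_left integrable_real_indicator) (auto simp: emeasure_eq_measure)
  have "fluid_departed {p<..p'} q \<le> (LINT u|L. indicator {p<..p'} u * F (q - p))"
    unfolding fluid_departed_def
  proof (rule integral_mono[OF integrable_departed int])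
    show "indicator {p<..p'} u * F (q - u) \<le> indicator {p<..p'} u * F (q - p)" for u
      using monoD[OF F_mono, of "q - u" "q - p"] by (cases "u \<in> {p<..p'}") simp_all
  qed simp
  moreover have "(LINT u|L. indicator {p<..p'} u * F (q - p')) \<le> fluid_departed {p<..p'} q"
    unfolding fluid_departed_def
  proof (rule integral_mono[OF int integrable_departed])
    show "indicator {p<..p'} u * F (q - p') \<le> indicator {p<..p'} u * F (q - u)" for u
      using monoD[OF F_mono, of "q - p'" "q - u"] by (cases "u \<in> {p<..p'}") simp_all
  qed simp
  ultimately show "fluid_departed {0<..p'} q - fluid_departed {0<..p} q \<le> (cdf L p' - cdf L p) * F (q - p)"
    and "(cdf L p' - cdf L p) * F (q - p') \<le> fluid_departed {0<..p'} q - fluid_departed {0<..p} q"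
    unfolding cdf const by linarith+
qed

text \<open>
  Cutting \<open>(0, p]\<close> into short pieces, the bounds on the increments over each piece converge, and
  the limiting bounds also enclose the fluid departures. Their gap is controlled by the modulus of
  continuity of \<open>F\<close>.
\<close>

lemma departed_in_prefix_limit:
  assumes p: "p \<in> \<rat>" "0 \<le> p" "p \<le> q" and q: "q \<in> \<rat>" "q \<le> H + 1"
  shows "(\<lambda>n. departed_in {0<..p} n q) \<longlonglongrightarrow> fluid_departed {0<..p} q"
proof (rule tendstoI)
  fix \<epsilon> :: real assume \<epsilon>: "\<epsilon> > 0"
  define \<eta> where "\<eta> = \<epsilon> / (2 * (cdf L p + 1))"
  have \<eta>: "\<eta> > 0" using \<epsilon> cdf_nonneg[of p] by (simp add: \<eta>_def)
  have "\<eta> * cdf L p \<le> \<epsilon> / 2"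
    using \<epsilon> cdf_nonneg[of p] by (simp add: \<eta>_def field_simps)
  have "uniformly_continuous_on {0..q} F"
    using F_cont by (intro compact_uniformly_continuous continuous_at_imp_continuous_on) auto
  then have "\<exists>\<delta>>0. \<forall>u\<in>{0..q}. \<forall>v\<in>{0..q}. dist v u < \<delta> \<longrightarrow> dist (F v) (F u) < \<eta>"
    unfolding uniformly_continuous_on_def using \<eta> by blast
  then obtain \<delta> where \<delta>: "\<delta> > 0"
    and uc: "\<And>u v. u \<in> {0..q} \<Longrightarrow> v \<in> {0..q} \<Longrightarrow> \<bar>v - u\<bar> < \<delta> \<Longrightarrow> \<bar>F v - F u\<bar> < \<eta>"
    unfolding dist_real_def by blast
  obtain m :: nat where m: "p < real m * \<delta>"
    using reals_Archimedean3[OF \<delta>] by blast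
  have m_pos: "0 < m" using m p by (cases m) auto
  define a where "a k = real k * p / real m" for k
  have a_rat: "a k \<in> \<rat>" for k using p by (simp add: a_def)
  have a_mono: "0 \<le> a k" "a k \<le> a (Suc k)" for k
    using p by (auto simp: a_def intro!: divide_right_mono mult_right_mono)
  have a_le: "a k \<le> p" if "k \<le> m" for k
    using p m_pos that by (simp add: a_def field_simps mult_left_mono)
  have a_end: "a 0 = 0" "a m = p" using m_pos by (auto simp: a_def)
  have a_step: "a (Suc k) - a k < \<delta>" for k
    using m m_pos by (simp add: a_def field_simps)
  define up where "up n = (\<Sum>k<m. short_services n (a (Suc k)) (q - a k) - short_services n (a k) (q - a k))" for n
  define lo where "lo n = (\<Sum>k<m. short_services n (a (Suc k)) (q - a (Suc k)) - short_services n (a k) (q - a (Suc k)))" for n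
  define UP where "UP = (\<Sum>k<m. cdf L (a (Suc k)) * F (q - a k) - cdf L (a k) * F (q - a k))"
  define LO where "LO = (\<Sum>k<m. cdf L (a (Suc k)) * F (q - a (Suc k)) - cdf L (a k) * F (q - a (Suc k)))"
  have ss: "(\<lambda>n. short_services n (a k) y) \<longlonglongrightarrow> cdf L (a k) * F y" if "k \<le> m" "y \<in> \<rat>" for k y
  proof (rule short_services_limit[OF a_rat a_mono(1) _ that(2)])
    show "a k \<le> H + 1" using a_le[OF that(1)] p(3) q(2) by linarith
  qed
  have rat: "q - a k \<in> \<rat>" for k using q(1) a_rat by (rule Rats_diff)
  have lim: "up \<longlonglongrightarrow> UP" "lo \<longlonglongrightarrow> LO"
    unfolding up_def UP_def lo_def LO_def by (intro tendsto_sum tendsto_diff ss rat; simp)+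
  have ev: "eventually (\<lambda>n. dist (up n) UP < \<epsilon> / 2) sequentially" "eventually (\<lambda>n. dist (lo n) LO < \<epsilon> / 2) sequentially"
    by (rule tendstoD[OF lim(1) half_gt_zero[OF \<epsilon>]], rule tendstoD[OF lim(2) half_gt_zero[OF \<epsilon>]])
  have fl: "LO \<le> fluid_departed {0<..p} q" "fluid_departed {0<..p} q \<le> UP"
  proof -
    have "(\<Sum>k<m. fluid_departed {0<..a (Suc k)} q - fluid_departed {0<..a k} q) = fluid_departed {0<..p} q"
      by (subst sum_lessThan_telescope) (simp add: a_end fluid_departed_def)
    moreover have "LO \<le> (\<Sum>k<m. fluid_departed {0<..a (Suc k)} q - fluid_departed {0<..a k} q)"
      unfolding LO_def using fluid_departed_prefix_increment(2)[OF a_mono]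
      by (intro sum_mono) (simp add: left_diff_distrib)
    moreover have "(\<Sum>k<m. fluid_departed {0<..a (Suc k)} q - fluid_departed {0<..a k} q) \<le> UP"
      unfolding UP_def using fluid_departed_prefix_increment(1)[OF a_mono]
      by (intro sum_mono) (simp add: left_diff_distrib)
    ultimately show "LO \<le> fluid_departed {0<..p} q" "fluid_departed {0<..p} q \<le> UP" by auto
  qed
  have "UP - LO = (\<Sum>k<m. (cdf L (a (Suc k)) - cdf L (a k)) * (F (q - a k) - F (q - a (Suc k))))"
    unfolding UP_def LO_def sum_subtractf[symmetric] by (intro sum.cong refl) (simp add: algebra_simps)
  also have "\<dots> \<le> (\<Sum>k<m. (cdf L (a (Suc k)) - cdf L (a k)) * \<eta>)"
  proof (intro sum_mono mult_left_mono)
    fix k assume k: "k \<in> {..<m}"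
    then have "a (Suc k) \<le> q" using a_le[of "Suc k"] p by simp
    then have "\<bar>F (q - a k) - F (q - a (Suc k))\<bar> < \<eta>"
      using a_mono[of k] a_step[of k] by (intro uc) auto
    then show "F (q - a k) - F (q - a (Suc k)) \<le> \<eta>" by simp
    show "0 \<le> cdf L (a (Suc k)) - cdf L (a k)" using cdf_nondecreasing a_mono(2) by simp
  qed
  also have "\<dots> = cdf L p * \<eta>"
    unfolding sum_distrib_right[symmetric] by (subst sum_lessThan_telescope) (simp add: a_end cdf_L_nonpos)
  finally have gap: "UP - LO \<le> \<epsilon> / 2"
    using \<open>\<eta> * cdf L p \<le> \<epsilon> / 2\<close> by (simp add: mult.commute)
  show "eventually (\<lambda>n. dist (departed_in {0<..p} n q) (fluid_departed {0<..p} q) < \<epsilon>) sequentially"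
    using ev eventually_ge_at_top[of 1]
  proof eventually_elim
    case (elim n)
    have tel: "(\<Sum>k<m. departed_in {0<..a (Suc k)} n q - departed_in {0<..a k} n q) = departed_in {0<..p} n q"
      by (subst sum_lessThan_telescope) (simp add: a_end departed_in_def)
    have step: "a (Suc k) \<le> q" if "k < m" for k using a_le[of "Suc k"] p that by simp
    have "(\<Sum>k<m. departed_in {0<..a (Suc k)} n q - departed_in {0<..a k} n q) \<le> up n"
      unfolding up_def using step a_mono by (intro sum_mono departed_in_prefix_increment(1)[OF elim(3)]) auto
    moreover have "lo n \<le> (\<Sum>k<m. departed_in {0<..a (Suc k)} n q - departed_in {0<..a k} n q)"
      unfolding lo_def using step a_mono by (intro sum_mono departed_in_prefix_increment(2)[OF elim(3)]) auto
    ultimately show ?case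
      using tel fl gap elim(1,2) unfolding dist_real_def by linarith
  qed
qed

lemma typical_prefix:
  assumes p: "p \<in> \<rat>" "0 \<le> p" "p \<le> H + 1"
  shows "typical {0<..p}"
  unfolding typical_def
proof (intro conjI allI impI)
  fix \<epsilon> :: real assume \<epsilon>: "\<epsilon> > 0"
  have "eventually (\<lambda>n. \<forall>t\<in>{0..H}. \<bar>arrived_in {0<..p} n t - measure L ({0<..p} \<inter> {..t})\<bar> \<le> \<epsilon>) sequentially"
  proof (rule monotone_uniform_limit[OF _ isCont_measure_atMost _ \<epsilon>])
    fix q assume q: "q \<in> \<rat>" "0 \<le> q" "q \<le> H + 1"
    have "(\<lambda>n. real (arrivals_upto n (min p q)) / real n) \<longlonglongrightarrow> cdf L (min p q)"
      using p q by (intro arrivals) (auto simp: min_def)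
    moreover have "eventually (\<lambda>n. real (arrivals_upto n (min p q)) / real n = arrived_in {0<..p} n q) sequentially"
      using eventually_ge_at_top[of 1] by eventually_elim (simp add: arrived_in_prefix)
    moreover have "cdf L (min p q) = measure L ({0<..p} \<inter> {..q})"
    proof -
      have "{0<..p} \<inter> {..q} = {0<..min p q}" by auto
      moreover have "cdf L (min p q) - cdf L 0 = measure L {0<..min p q}"
        using cdf_diff_eq[of 0 "min p q"] p q by (cases "0 < min p q") (auto simp: min_def split: if_splits)
      ultimately show ?thesis using cdf_L_nonpos[of 0] by simp
    qed
    ultimately show "(\<lambda>n. arrived_in {0<..p} n q) \<longlonglongrightarrow> measure L ({0<..p} \<inter> {..q})"
      by (simp add: filterlim_cong)
  qed (auto intro: arrived_in_mono)
  moreover have "eventually (\<lambda>n. \<forall>t\<in>{0..H}. \<bar>departed_in {0<..p} n t - fluid_departed {0<..p} t\<bar> \<le> \<epsilon>) sequentially"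
  proof (rule monotone_uniform_limit[OF _ isCont_fluid_departed _ \<epsilon>])
    fix q assume q: "q \<in> \<rat>" "0 \<le> q" "q \<le> H + 1"
    have "(\<lambda>n. departed_in {0<..min p q} n q) \<longlonglongrightarrow> fluid_departed {0<..min p q} q"
      using p q by (intro departed_in_prefix_limit) (auto simp: min_def)
    moreover have "eventually (\<lambda>n. departed_in {0<..min p q} n q = departed_in {0<..p} n q) sequentially"
      using eventually_ge_at_top[of 1] by eventually_elim (simp add: departed_in_prefix)
    moreover have "fluid_departed {0<..min p q} q = fluid_departed {0<..p} q"
      unfolding fluid_departed_def
      by (intro Bochner_Integration.integral_cong) (auto simp: indicator_def F_nonpos)
    ultimately show "(\<lambda>n. departed_in {0<..p} n q) \<longlonglongrightarrow> fluid_departed {0<..p} q"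
      by (simp add: filterlim_cong)
  qed (auto intro: departed_in_mono)
  ultimately show "eventually (\<lambda>n. \<forall>t\<in>{0..H}. \<bar>arrived_in {0<..p} n t - measure L ({0<..p} \<inter> {..t})\<bar> \<le> \<epsilon> \<and>
      \<bar>departed_in {0<..p} n t - fluid_departed {0<..p} t\<bar> \<le> \<epsilon>) sequentially"
    by eventually_elim blast
qed auto

lemma additive:
  assumes "A \<in> sets borel" "B \<in> sets borel" "A \<inter> B = {}"
  shows "arrived_in (A \<union> B) n t = arrived_in A n t + arrived_in B n t"
    and "departed_in (A \<union> B) n t = departed_in A n t + departed_in B n t"
    and "measure L ((A \<union> B) \<inter> {..t}) = measure L (A \<inter> {..t}) + measure L (B \<inter> {..t})"
proof -
  have ind: "indicator (A \<union> B) y = indicator A y + (indicator B y :: real)" for y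
    using assms(3) by (auto simp: indicator_def)
  show "arrived_in (A \<union> B) n t = arrived_in A n t + arrived_in B n t"
    by (simp add: arrived_in_def ind sum.distrib add_divide_distrib)
  show "departed_in (A \<union> B) n t = departed_in A n t + departed_in B n t"
    by (simp add: departed_in_def ind sum.distrib add_divide_distrib distrib_right)
  show "measure L ((A \<union> B) \<inter> {..t}) = measure L (A \<inter> {..t}) + measure L (B \<inter> {..t})"
    unfolding Int_Un_distrib2 using assms by (intro finite_measure_Union) auto
qed

lemma typical_Un:
  assumes A: "typical A" and B: "typical B" and disj: "A \<inter> B = {}"
  shows "typical (A \<union> B)"
  unfolding typical_def
proof (intro conjI allI impI)
  have AB: "A \<in> sets borel" "B \<in> sets borel" using A B by (auto simp: typical_def)
  then show "A \<union> B \<in> sets borel" by auto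
  fix \<epsilon> :: real assume "\<epsilon> > 0"
  then have "\<epsilon> / 2 > 0" by simp
  with A B have "eventually (\<lambda>n. \<forall>t\<in>{0..H}. \<bar>arrived_in A n t - measure L (A \<inter> {..t})\<bar> \<le> \<epsilon> / 2 \<and>
      \<bar>departed_in A n t - fluid_departed A t\<bar> \<le> \<epsilon> / 2) sequentially"
    "eventually (\<lambda>n. \<forall>t\<in>{0..H}. \<bar>arrived_in B n t - measure L (B \<inter> {..t})\<bar> \<le> \<epsilon> / 2 \<and>
      \<bar>departed_in B n t - fluid_departed B t\<bar> \<le> \<epsilon> / 2) sequentially"
    unfolding typical_def by blast+
  then show "eventually (\<lambda>n. \<forall>t\<in>{0..H}. \<bar>arrived_in (A \<union> B) n t - measure L ((A \<union> B) \<inter> {..t})\<bar> \<le> \<epsilon> \<and>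
      \<bar>departed_in (A \<union> B) n t - fluid_departed (A \<union> B) t\<bar> \<le> \<epsilon>) sequentially"
  proof eventually_elim
    case (elim n)
    show ?case
    proof
      fix t assume t: "t \<in> {0..H}"
      from elim(1)[rule_format, OF t] elim(2)[rule_format, OF t]
      show "\<bar>arrived_in (A \<union> B) n t - measure L ((A \<union> B) \<inter> {..t})\<bar> \<le> \<epsilon> \<and>
          \<bar>departed_in (A \<union> B) n t - fluid_departed (A \<union> B) t\<bar> \<le> \<epsilon>"
        unfolding additive[OF AB disj] fluid_departed_Un[OF AB disj] by linarith
    qed
  qed
qed

lemma typical_Diff:
  assumes A: "typical A" and B: "typical B" and sub: "B \<subseteq> A"
  shows "typical (A - B)"
  unfolding typical_def
proof (intro conjI allI impI)
  have AB: "A - B \<in> sets borel" "B \<in> sets borel" using A B by (auto simp: typical_def)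
  then show "A - B \<in> sets borel" by auto
  have disj: "(A - B) \<inter> B = {}" and un: "(A - B) \<union> B = A" using sub by auto
  fix \<epsilon> :: real assume "\<epsilon> > 0"
  then have "\<epsilon> / 2 > 0" by simp
  with A B have "eventually (\<lambda>n. \<forall>t\<in>{0..H}. \<bar>arrived_in A n t - measure L (A \<inter> {..t})\<bar> \<le> \<epsilon> / 2 \<and>
      \<bar>departed_in A n t - fluid_departed A t\<bar> \<le> \<epsilon> / 2) sequentially"
    "eventually (\<lambda>n. \<forall>t\<in>{0..H}. \<bar>arrived_in B n t - measure L (B \<inter> {..t})\<bar> \<le> \<epsilon> / 2 \<and>
      \<bar>departed_in B n t - fluid_departed B t\<bar> \<le> \<epsilon> / 2) sequentially"
    unfolding typical_def by blast+
  then show "eventually (\<lambda>n. \<forall>t\<in>{0..H}. \<bar>arrived_in (A - B) n t - measure L ((A - B) \<inter> {..t})\<bar> \<le> \<epsilon> \<and>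
      \<bar>departed_in (A - B) n t - fluid_departed (A - B) t\<bar> \<le> \<epsilon>) sequentially"
  proof eventually_elim
    case (elim n)
    show ?case
    proof
      fix t assume t: "t \<in> {0..H}"
      from elim(1)[rule_format, OF t] elim(2)[rule_format, OF t]
        additive(1)[OF AB disj, of n t] additive(2)[OF AB disj, of n t] additive(3)[OF AB disj, of t]
        fluid_departed_Un[OF AB disj, of t]
      show "\<bar>arrived_in (A - B) n t - measure L ((A - B) \<inter> {..t})\<bar> \<le> \<epsilon> \<and>
          \<bar>departed_in (A - B) n t - fluid_departed (A - B) t\<bar> \<le> \<epsilon>"
        unfolding un by linarith
    qed
  qed
qed

lemma typical_cells:
  assumes a: "\<And>k. a k \<in> \<rat>" "\<And>k. 0 \<le> a k" "mono a" and K: "finite K" "\<And>k. k \<in> K \<Longrightarrow> a (Suc k) \<le> H + 1"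
  shows "typical (\<Union>k\<in>K. {a k<..a (Suc k)})"
  using K
proof (induction K rule: finite_induct)
  case empty
  show ?case by (auto simp: typical_def arrived_in_def departed_in_def fluid_departed_def)
next
  case (insert k K)
  have ak: "a k \<le> a (Suc k)" using a(3) by (simp add: monoD)
  have "typical ({0<..a (Suc k)} - {0<..a k})"
    using insert.prems[of k] ak a by (intro typical_Diff typical_prefix) auto
  moreover have "{0<..a (Suc k)} - {0<..a k} = {a k<..a (Suc k)}" using a(2)[of k] by auto
  ultimately have "typical {a k<..a (Suc k)}" by simp
  moreover have "{a k<..a (Suc k)} \<inter> (\<Union>j\<in>K. {a j<..a (Suc j)}) = {}"
  proof -
    have "{a k<..a (Suc k)} \<inter> {a j<..a (Suc j)} = {}" if "j \<in> K" for j
    proof (cases "j < k")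
      case True
      then have "a (Suc j) \<le> a k" using a(3) by (simp add: monoD)
      then show ?thesis by auto
    next
      case False
      then have "k < j" using that insert.hyps(2) by (cases "j = k") auto
      then have "a (Suc k) \<le> a j" using a(3) by (simp add: monoD)
      then show ?thesis by auto
    qed
    then show ?thesis by blast
  qed
  ultimately show ?case
    using insert by (simp add: typical_Un)
qed

text \<open>
  The times at which a continuous function is below \<open>1\<close> but within \<open>2 * \<kappa>\<close> of it decrease to the
  empty set as \<open>\<kappa>\<close> tends to \<open>0\<close>.
\<close>

lemma small_band:
  fixes D :: "real \<Rightarrow> real"
  assumes D: "\<And>t. isCont D t" and e: "e > 0" and c: "c > 0"
  obtains \<kappa> where "0 < \<kappa>" "\<kappa> \<le> c" "measure L {u\<in>{0<..H}. 1 - 2 * \<kappa> \<le> D u \<and> D u < 1} \<le> e"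
proof -
  define U where "U k = {u\<in>{0<..H}. 1 - 1 / real (Suc k) \<le> D u \<and> D u < 1}" for k
  have [measurable]: "D \<in> borel_measurable borel"
    using D by (intro borel_measurable_continuous_onI continuous_at_imp_continuous_on) auto
  have U: "U k \<in> sets borel" for k
    unfolding U_def by measurable
  have "decseq U"
  proof (rule decseq_SucI)
    fix k :: nat
    have "1 / real (Suc (Suc k)) \<le> 1 / real (Suc k)" by (simp add: frac_le)
    then show "U (Suc k) \<subseteq> U k" unfolding U_def by auto
  qed
  then have "(\<lambda>k. measure L (U k)) \<longlonglongrightarrow> measure L (\<Inter>k. U k)"
    using U by (intro finite_Lim_measure_decseq) auto
  moreover have "(\<Inter>k. U k) = {}"
  proof -
    have "\<exists>k. u \<notin> U k" for u
    proof (cases "D u < 1")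
      case True
      then obtain k :: nat where "1 / real (Suc k) < 1 - D u"
        using nat_approx_posE[of "1 - D u"] by auto
      then show ?thesis by (intro exI[of _ k]) (auto simp: U_def)
    qed (auto simp: U_def)
    then show ?thesis by auto
  qed
  ultimately have "(\<lambda>k. measure L (U k)) \<longlonglongrightarrow> 0" by simp
  then have "eventually (\<lambda>k. measure L (U k) < e) sequentially"
    using e by (rule order_tendstoD)
  then obtain k where k: "measure L (U k) < e" by (auto simp: eventually_sequentially)
  define \<kappa> where "\<kappa> = min c (1 / (2 * real (Suc k)))"
  have "2 * \<kappa> \<le> 1 / real (Suc k)" by (simp add: \<kappa>_def min_def field_simps)
  then have "{u\<in>{0<..H}. 1 - 2 * \<kappa> \<le> D u \<and> D u < 1} \<subseteq> U k" by (auto simp: U_def)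
  then have "measure L {u\<in>{0<..H}. 1 - 2 * \<kappa> \<le> D u \<and> D u < 1} \<le> measure L (U k)"
    using U by (intro finite_measure_mono) auto
  then show thesis using k c that[of \<kappa>] by (simp add: \<kappa>_def)
qed

text \<open>
  The acceptance set \<open>G\<close> of the fluid solution \<open>D\<close> is only known to be open, so it is replaced by a
  union \<open>C\<close> of grid cells on which \<open>D\<close> is below about \<open>1 - \<kappa>'\<close>, and \<open>C\<close> defines the ideal system.
  Its cells \<open>W\<close> on which \<open>D\<close> is above about \<open>1 - \<kappa>\<close> hold the exceptional arrivals; they lie in a
  band below \<open>1\<close> whose mass is at most \<open>e\<close>.

  Two scales are needed. Off \<open>C\<close> the ideal system must be closer to full than it is on \<open>C - W\<close>, by a
  margin that survives passing from \<open>G\<close> to \<open>C\<close> and from the fluid model to finite \<open>n\<close>. So \<open>\<kappa>'\<close> is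
  chosen after \<open>\<kappa>\<close>, such that both \<open>\<kappa>'\<close> and the mass of its band are small compared with \<open>\<kappa>\<close>. The
  comparison is made at the intermediate level \<open>1 - \<kappa> / 2\<close>.
\<close>

theorem occupied_converges:
  assumes H: "H > 0" and e: "e > 0"
    and G: "G \<in> sets borel" "\<And>u. u \<in> {0<..H} \<Longrightarrow> u \<in> G \<longleftrightarrow> fluid_occupancy G u < 1"
  shows "eventually (\<lambda>n. \<forall>t\<in>{0..H}. \<bar>r n t - fluid_occupancy G t\<bar> \<le> 3 * e) sequentially"
proof -
  define D where "D = fluid_occupancy G"
  have D: "isCont D t" for t unfolding D_def by (rule isCont_fluid_occupancy[OF G(1)])
  have G_iff: "u \<in> G \<longleftrightarrow> D u < 1" if "u \<in> {0<..H}" for u using G(2)[OF that] by (simp add: D_def)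
  have [measurable]: "D \<in> borel_measurable borel"
    using D by (intro borel_measurable_continuous_onI continuous_at_imp_continuous_on) auto
  obtain \<kappa> where \<kappa>: "0 < \<kappa>" "\<kappa> \<le> e" "measure L {u\<in>{0<..H}. 1 - 2 * \<kappa> \<le> D u \<and> D u < 1} \<le> e"
    using small_band[OF D e e] by blast
  have "\<kappa> / 8 > 0" "\<kappa> / 16 > 0" using \<kappa>(1) by auto
  then obtain \<kappa>' where \<kappa>': "0 < \<kappa>'" "\<kappa>' \<le> \<kappa> / 16" "measure L {u\<in>{0<..H}. 1 - 2 * \<kappa>' \<le> D u \<and> D u < 1} \<le> \<kappa> / 8"
    using small_band[OF D] by blast
  have "uniformly_continuous_on {0..H + 1} D"
    using D by (intro compact_uniformly_continuous continuous_at_imp_continuous_on) auto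
  then have "\<exists>\<delta>>0. \<forall>u\<in>{0..H + 1}. \<forall>v\<in>{0..H + 1}. dist v u < \<delta> \<longrightarrow> dist (D v) (D u) < \<kappa>'"
    unfolding uniformly_continuous_on_def using \<kappa>'(1) by blast
  then obtain \<delta> where \<delta>: "\<delta> > 0"
    and uc: "\<And>u v. u \<in> {0..H + 1} \<Longrightarrow> v \<in> {0..H + 1} \<Longrightarrow> \<bar>v - u\<bar> < \<delta> \<Longrightarrow> \<bar>D v - D u\<bar> < \<kappa>'"
    unfolding dist_real_def by blast
  obtain m0 :: nat where "1 / real (Suc m0) < min \<delta> 1"
    using nat_approx_posE[of "min \<delta> 1"] \<delta> by auto
  then obtain m :: nat where m: "0 < m" "1 / real m < \<delta>" "1 / real m < 1"
    by (metis min_less_iff_conj zero_less_Suc)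
  define a where "a k = real k / real m" for k
  define M where "M = nat \<lceil>H * real m\<rceil>"
  define K where "K = {k. k < M \<and> D (a k) < 1 - \<kappa>'}"
  define KW where "KW = {k. k < M \<and> D (a k) < 1 - \<kappa>' \<and> 1 - \<kappa> \<le> D (a k)}"
  define C where "C = (\<Union>k\<in>K. {a k<..a (Suc k)})"
  define W where "W = (\<Union>k\<in>KW. {a k<..a (Suc k)})"
  have a_rat: "a k \<in> \<rat>" "0 \<le> a k" for k by (auto simp: a_def)
  have a_Suc: "a (Suc k) = a k + 1 / real m" for k by (simp add: a_def add_divide_distrib)
  have a_mono: "mono a" by (intro monoI) (simp add: a_def divide_right_mono)
  have a_lt: "a k < H" if "k < M" for k
  proof -
    have "real k < H * real m" using that unfolding M_def by linarith
    then show ?thesis using m(1) by (simp add: a_def field_simps)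
  qed
  then have a_le: "a (Suc k) \<le> H + 1" if "k < M" for k
    using that m(3) a_lt[OF that] unfolding a_Suc by linarith
  have C_typ: "typical C" and W_typ: "typical W"
    unfolding C_def W_def using a_le by (auto intro!: typical_cells a_rat a_mono simp: K_def KW_def)
  have [measurable]: "C \<in> sets borel" "W \<in> sets borel" using C_typ W_typ by (auto simp: typical_def)
  note [measurable] = G(1)
  have cell: "\<exists>k<M. u \<in> {a k<..a (Suc k)}" if u: "u \<in> {0<..H}" for u
  proof -
    define k where "k = nat (\<lceil>u * real m\<rceil> - 1)"
    have um: "0 < u * real m" using u m by simp
    then have k: "real k = real_of_int \<lceil>u * real m\<rceil> - 1"
      unfolding k_def by (simp add: of_nat_nat)
    have "real k < u * real m" "u * real m \<le> real (Suc k)"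
      using k by (auto, linarith+)
    then have "u \<in> {a k<..a (Suc k)}" using m by (simp add: a_def field_simps)
    moreover have "u * real m \<le> H * real m" using u by (intro mult_right_mono) auto
    then have "k < M" using \<open>real k < u * real m\<close> unfolding M_def by linarith
    ultimately show ?thesis by blast
  qed
  have osc: "\<bar>D u - D (a k)\<bar> < \<kappa>'" if "k < M" "u \<in> {a k<..a (Suc k)}" for u k
    using that a_le[OF that(1)] a_rat(2)[of k] m(2) unfolding a_Suc by (intro uc) auto
  have outside: "1 - 2 * \<kappa>' \<le> D u" if uH: "u \<in> {0<..H}" "u \<notin> C" for u
  proof -
    obtain k where k: "k < M" "u \<in> {a k<..a (Suc k)}" using cell[OF uH(1)] by blast
    then have "k \<notin> K" using uH by (auto simp: C_def)
    then show ?thesis using k osc[OF k] by (auto simp: K_def)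
  qed
  have inside: "D u < 1" if uC: "u \<in> C" for u
  proof -
    obtain k where k: "k < M" "u \<in> {a k<..a (Suc k)}" "D (a k) < 1 - \<kappa>'" using uC by (auto simp: C_def K_def)
    then show ?thesis using osc[OF k(1,2)] by auto
  qed
  have safe: "D u < 1 - \<kappa> + \<kappa>'" if uC: "u \<in> C" "u \<notin> W" for u
  proof -
    obtain k where k: "k < M" "u \<in> {a k<..a (Suc k)}" "D (a k) < 1 - \<kappa>'" using uC(1) by (auto simp: C_def K_def)
    then have "k \<notin> KW" using uC(2) by (auto simp: W_def)
    then have "D (a k) < 1 - \<kappa>" using k by (auto simp: KW_def)
    then show ?thesis using osc[OF k(1,2)] by auto
  qed
  have middle: "1 - 2 * \<kappa> \<le> D u \<and> D u < 1" if uW: "u \<in> W" for u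
  proof -
    obtain k where k: "k < M" "u \<in> {a k<..a (Suc k)}" "D (a k) < 1 - \<kappa>'" "1 - \<kappa> \<le> D (a k)"
      using uW by (auto simp: W_def KW_def)
    then show ?thesis using osc[OF k(1,2)] \<kappa>'(2) \<kappa>(1) by auto
  qed
  have W_pos: "u > 0" if "u \<in> W" for u
    using that a_rat(2) by (auto simp: W_def intro: le_less_trans)
  have W_small: "measure L (W \<inter> {..H}) \<le> e"
  proof -
    have "measure L (W \<inter> {..H}) \<le> measure L {u\<in>{0<..H}. 1 - 2 * \<kappa> \<le> D u \<and> D u < 1}"
      using middle W_pos by (intro finite_measure_mono) auto
    then show ?thesis using \<kappa>(3) by simp
  qed
  have near: "fluid_occupancy C t \<le> D t" "D t - fluid_occupancy C t \<le> \<kappa> / 8" if t: "t \<in> {0..H}" for t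
  proof -
    have sub: "C \<inter> {0<..t} \<subseteq> G" using inside G_iff t by auto
    show "fluid_occupancy C t \<le> D t"
      unfolding D_def by (rule fluid_occupancy_mono_set(1)[OF G(1) _ sub]) measurable
    have "D t - fluid_occupancy C t \<le> measure L ((G - C) \<inter> {0<..t})"
      unfolding D_def by (rule fluid_occupancy_mono_set(2)[OF G(1) _ sub]) measurable
    also have "\<dots> \<le> measure L {u\<in>{0<..H}. 1 - 2 * \<kappa>' \<le> D u \<and> D u < 1}"
      using outside G_iff t by (intro finite_measure_mono) auto
    finally show "D t - fluid_occupancy C t \<le> \<kappa> / 8" using \<kappa>'(3) by simp
  qed
  have ev_C: "eventually (\<lambda>n. \<forall>t\<in>{0..H}. \<bar>arrived_in C n t - measure L (C \<inter> {..t})\<bar> \<le> \<kappa> / 16 \<and>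
      \<bar>departed_in C n t - fluid_departed C t\<bar> \<le> \<kappa> / 16) sequentially"
    using C_typ \<open>\<kappa> / 16 > 0\<close> unfolding typical_def by blast
  have ev_W: "eventually (\<lambda>n. \<forall>t\<in>{0..H}. \<bar>arrived_in W n t - measure L (W \<inter> {..t})\<bar> \<le> e \<and>
      \<bar>departed_in W n t - fluid_departed W t\<bar> \<le> e) sequentially"
    using W_typ e unfolding typical_def by blast
  have ev_n: "eventually (\<lambda>n. 1 / real n < \<kappa> / 4) sequentially"
    using \<kappa>(1) by (intro order_tendstoD[OF lim_1_over_n]) auto
  show ?thesis
    using ev_C ev_W ev_n eventually_ge_at_top[of 1]
  proof eventually_elim
    case (elim n)
    interpret loss_path "\<tau> n" n "s n" "r n" by (rule path[OF elim(4)])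
    have n0: "real n > 0" using elim(4) by simp
    define J where "J t = arrived_in C n t - departed_in C n t" for t
    have J: "real (in_service (\<lambda>i. x i \<in> C) t) = real n * J t" for t
    proof -
      have "real (in_service (\<lambda>i. x i \<in> C) t)
          = (\<Sum>i<arrived t. indicator C (x i) - indicator C (x i) * of_bool (s n i \<le> t - x i))"
        unfolding in_service_eq_sum by (intro sum.cong refl) (auto simp: indicator_def)
      then show ?thesis
        using n0 by (simp add: J_def arrived_in_def departed_in_def sum_subtractf right_diff_distrib)
    qed
    have J_near: "\<bar>J t - fluid_occupancy C t\<bar> \<le> \<kappa> / 8" if "t \<in> {0..H}" for t
      using elim(1)[rule_format, OF that] unfolding J_def fluid_occupancy_def by linarith
    have W_count: "real (card {i. i < arrived H \<and> x i \<in> W}) \<le> real n * (2 * e)"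
    proof -
      have "arrived_in W n H \<le> 2 * e"
        using elim(2)[rule_format, of H] W_small H by auto
      moreover have "(\<Sum>i<arrived H. indicator W (x i)) = real (card {i. i < arrived H \<and> x i \<in> W})"
        by (simp add: indicator_def sum.If_cases Int_def)
      ultimately show ?thesis
        using n0 by (simp add: arrived_in_def field_simps)
    qed
    have x_in: "x i \<in> {0<..H}" if "i < arrived H" for i
      using x_pos[OF epoch_finite[OF that]] less_arrived_iff[OF epoch_finite[OF that], of H] that by simp
    show ?case
    proof
      fix t assume t: "t \<in> {0..H}"
      have "\<bar>real n * r n t - real (in_service (\<lambda>i. x i \<in> C) t)\<bar>
          \<le> real n * (\<kappa> / 2) + real (card {i. i < arrived H \<and> x i \<in> W})"
      proof (rule occupied_near_ideal[OF _ _ _ t])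
        show "0 \<le> \<kappa> / 2" using \<kappa>(1) by simp
        fix i assume i: "i < arrived H"
        have xi: "x i \<in> {0..H}" using x_in[OF i] by simp
        show "real n * (1 - \<kappa> / 2) \<le> real (in_service (\<lambda>i. x i \<in> C) (x i))" if "x i \<notin> C"
        proof -
          have "1 - \<kappa> / 2 \<le> J (x i)"
            using outside[OF x_in[OF i] that] J_near[OF xi] near(2)[OF xi] \<kappa>'(2) by linarith
          then show ?thesis unfolding J using n0 by (intro mult_left_mono) auto
        qed
        show "eventually (\<lambda>u. real (in_service (\<lambda>i. x i \<in> C) u) + 1 \<le> real n * (1 - \<kappa> / 2)) (at_left (x i))"
          if "x i \<in> C" "x i \<notin> W"
        proof -
          have "(D \<longlongrightarrow> D (x i)) (at_left (x i))"
            using D[of "x i"] by (auto simp: isCont_def filterlim_at_split)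
          then have "eventually (\<lambda>u. D u < 1 - \<kappa> + \<kappa>') (at_left (x i))"
            using safe[OF that] by (rule order_tendstoD)
          moreover have "eventually (\<lambda>u. u \<in> {0<..<x i}) (at_left (x i))"
            using x_in[OF i] by (intro eventually_at_left_real) auto
          ultimately show ?thesis
          proof eventually_elim
            case (elim u)
            then have u: "u \<in> {0..H}" using xi by auto
            have "J u + 1 / real n \<le> 1 - \<kappa> / 2"
              using J_near[OF u] near(1)[OF u] elim(1) \<kappa>'(2) \<open>1 / real n < \<kappa> / 4\<close> by linarith
            then have "real n * (J u + 1 / real n) \<le> real n * (1 - \<kappa> / 2)"
              using n0 by (intro mult_left_mono) auto
            then show ?case unfolding J using n0 by (simp add: distrib_left)
          qed
        qed
      qed
      also have "\<dots> \<le> real n * (\<kappa> / 2 + 2 * e)"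
        using W_count by (simp add: distrib_left)
      finally have "real n * \<bar>r n t - J t\<bar> \<le> real n * (\<kappa> / 2 + 2 * e)"
        unfolding J using n0 by (simp add: abs_mult flip: right_diff_distrib)
      then have "\<bar>r n t - J t\<bar> \<le> \<kappa> / 2 + 2 * e" using n0 by simp
      then have "\<bar>r n t - D t\<bar> \<le> 3 * e"
        using J_near[OF t] near[OF t] \<kappa>(1,2) by linarith
      then show "\<bar>r n t - fluid_occupancy G t\<bar> \<le> 3 * e"
        by (simp add: D_def)
    qed
  qed
qed

end

section \<open>Almost sure convergence\<close>

text \<open>
  The intensity on \<open>[0, H]\<close> as a Borel measure. The function \<open>h\<close> is tested for measurability on the
  open half-line only, because a left limit at \<open>0\<close> carries no information about the solution.
\<close>

lemma intensity_measure:
  assumes lam: "intensity lam" and H: "H \<ge> 0"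
  obtains L where "finite_borel_measure L" "\<And>x. measure L {x} = 0" "measure L {..0} = 0"
    "\<And>h t. t \<in> {0..H} \<Longrightarrow> (\<lambda>u. indicator {0<..} u * h u) \<in> borel_measurable borel \<Longrightarrow>
       (LINT u:{0..t}|lebesgue. h u * lam u) = (LINT u|L. indicator {0<..t} u * h u)"
proof -
  define g where "g u = indicator {0..H} u * lam u" for u
  have g0: "0 \<le> g u" for u
    using lam by (auto simp: g_def intensity_def indicator_def)
  have "set_integrable lebesgue {0..H} lam"
    using lam H by (auto simp: intensity_def)
  then have g_int: "integrable lebesgue g"
    by (simp add: set_integrable_def g_def[abs_def])
  then have g [measurable]: "g \<in> borel_measurable lebesgue" by auto
  define D where "D = density lebesgue (\<lambda>u. ennreal (g u))"
  define L where "L = distr D borel (\<lambda>u. u)"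
  have id: "(\<lambda>u. u) \<in> measurable D borel"
    unfolding D_def by (simp, rule measurable_completion) simp
  have L_eq: "emeasure L A = (\<integral>\<^sup>+u. ennreal (g u) * indicator A u \<partial>lebesgue)" if A: "A \<in> sets borel" for A
  proof -
    have "emeasure L A = emeasure D A"
      unfolding L_def using A id by (subst emeasure_distr) (auto simp: D_def)
    also have "\<dots> = (\<integral>\<^sup>+u. ennreal (g u) * indicator A u \<partial>lebesgue)"
      unfolding D_def using A by (intro emeasure_density) auto
    finally show ?thesis .
  qed
  have fin: "finite_borel_measure L"
  proof (intro finite_borel_measure.intro finite_borel_measure_axioms.intro finite_measureI)
    show "sets L = sets borel" by (simp add: L_def)
    have "emeasure L (space L) = (\<integral>\<^sup>+u. ennreal (g u) \<partial>lebesgue)"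
      using L_eq[of UNIV] by (simp add: L_def)
    also have "\<dots> < \<infinity>"
      using g_int g0 by (subst nn_integral_eq_integral) auto
    finally show "emeasure L (space L) \<noteq> \<infinity>" by simp
  qed
  have AE_ne: "AE u in lebesgue. u \<noteq> (c::real)" for c
    by (intro AE_completion AE_lborel_singleton)
  have null: "measure L {x} = 0" for x
  proof -
    have "AE u in lebesgue. ennreal (g u) * indicator {x} u = 0"
      using AE_ne[of x] by eventually_elim simp
    from nn_integral_cong_AE[OF this] show ?thesis
      using L_eq[of "{x}"] by (simp add: measure_def)
  qed
  have null0: "measure L {..0} = 0"
  proof -
    have "AE u in lebesgue. ennreal (g u) * indicator {..0} u = 0"
      using AE_ne[of 0] by eventually_elim (simp add: indicator_def g_def)
    from nn_integral_cong_AE[OF this] show ?thesis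
      using L_eq[of "{..0}"] by (simp add: measure_def)
  qed
  have "(LINT u:{0..t}|lebesgue. h u * lam u) = (LINT u|L. indicator {0<..t} u * h u)"
    if t: "t \<in> {0..H}" and h: "(\<lambda>u. indicator {0<..} u * h u) \<in> borel_measurable borel" for h t
  proof -
    define k where "k u = indicator {0<..t} u * h u" for u
    have "k = (\<lambda>u. indicator {..t} u * (indicator {0<..} u * h u))"
      by (auto simp: k_def indicator_def fun_eq_iff)
    then have k [measurable]: "k \<in> borel_measurable borel"
      using h by simp
    have k' [measurable]: "k \<in> borel_measurable lebesgue"
      using k by (intro measurable_completion) simp
    have "(LINT u|L. k u) = (LINT u|D. k u)"
      unfolding L_def by (rule integral_distr[OF id k])
    also have "\<dots> = (LINT u|lebesgue. g u *\<^sub>R k u)"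
      unfolding D_def by (rule integral_density) (use g0 in auto)
    also have "\<dots> = (LINT u|lebesgue. indicator {0..t} u *\<^sub>R (h u * lam u))"
    proof (rule integral_cong_AE)
      have "(\<lambda>u. indicator {0..t} u *\<^sub>R (h u * lam u)) = (\<lambda>u. g u *\<^sub>R k u + indicator {0} u * (h 0 * lam 0))"
        using t by (auto simp: g_def k_def indicator_def fun_eq_iff)
      moreover have "(indicator {0} :: real \<Rightarrow> real) \<in> borel_measurable lebesgue"
        by (intro borel_measurable_indicator) auto
      then have "(\<lambda>u. g u *\<^sub>R k u + indicator {0} u * (h 0 * lam 0)) \<in> borel_measurable lebesgue"
        by measurable
      ultimately show "(\<lambda>u. indicator {0..t} u *\<^sub>R (h u * lam u)) \<in> borel_measurable lebesgue"
        by (simp only:)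
      show "AE u in lebesgue. g u *\<^sub>R k u = indicator {0..t} u *\<^sub>R (h u * lam u)"
        by (intro eventually_mono[OF AE_ne[of 0]]) (use t in \<open>auto simp: g_def k_def indicator_def\<close>)
    qed simp
    finally show ?thesis by (simp add: set_lebesgue_integral_def k_def)
  qed
  then show thesis using that[OF fin null null0] by blast
qed

lemma service_distribution_cdf:
  assumes "service_distribution F \<nu>"
  shows "mono F" "isCont F x" "x \<le> 0 \<Longrightarrow> F x = 0" "F x \<le> 1"
proof -
  define N where "N = density lborel (\<lambda>x. ennreal (\<nu> x))"
  have \<nu> [measurable]: "\<nu> \<in> borel_measurable borel" and zero: "\<And>x. x < 0 \<Longrightarrow> \<nu> x = 0"
    and prob: "prob_space N" and F: "F = cdf N"
    using assms by (auto simp: service_distribution_def N_def)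
  interpret real_distribution N
    using prob by (simp add: real_distribution_def real_distribution_axioms_def N_def)
  have N: "emeasure N A = (\<integral>\<^sup>+u. ennreal (\<nu> u) * indicator A u \<partial>lborel)" if "A \<in> sets borel" for A
    unfolding N_def using that by (intro emeasure_density) auto
  have atomless: "measure N {y} = 0" for y
  proof -
    have "AE u in lborel. ennreal (\<nu> u) * indicator {y} u = 0"
      using AE_lborel_singleton[of y] by eventually_elim simp
    from nn_integral_cong_AE[OF this] show ?thesis
      using N[of "{y}"] by (simp add: measure_def)
  qed
  have "AE u in lborel. ennreal (\<nu> u) * indicator {..0} u = 0"
    using AE_lborel_singleton[of 0] by eventually_elim (auto simp: indicator_def zero)
  from nn_integral_cong_AE[OF this] have "cdf N 0 = 0"
    using N[of "{..0}"] by (simp add: cdf_def measure_def)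
  then show "x \<le> 0 \<Longrightarrow> F x = 0"
    using cdf_nondecreasing[of x 0] cdf_nonneg[of x] F by simp
  show "mono F" unfolding F by (intro monoI cdf_nondecreasing)
  show "isCont F x" unfolding F using isCont_cdf atomless by blast
  show "F x \<le> 1" unfolding F by (rule cdf_bounded_prob)
qed

lemma (in prob_space) AE_arrival_fraction:
  assumes sys: "\<And>n. n \<ge> 1 \<Longrightarrow> loss_system n lam F (T n) (S n) (R n)"
    and lam: "intensity lam" and t: "t \<ge> 0"
  shows "AE \<omega> in M. (\<lambda>n. real (arrival_count (T n) t \<omega>) / real n) \<longlonglongrightarrow> (LINT u:{0..t}|lebesgue. lam u)"
proof -
  define m where "m = (LINT u:{0..t}|lebesgue. lam u)"
  have m: "0 \<le> m"
    unfolding m_def set_lebesgue_integral_def using lam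
    by (intro integral_nonneg_AE AE_I2) (auto simp: intensity_def indicator_def)
  have "AE \<omega> in M. (\<lambda>n. (real (arrival_count (T n) t \<omega>) - real n * m) / real n) \<longlonglongrightarrow> 0"
  proof (rule AE_tendsto_zero_of_exp_moments[OF _ m])
    fix n :: nat assume n: "n \<ge> 1"
    have arr: "arrival_epochs M (T n)"
      using sys[OF n] by (auto simp: loss_system_def poisson_arrivals_def)
    have T: "T n i \<in> borel_measurable M" for i using arr by (auto simp: arrival_epochs_def)
    have iff: "i < arrival_count (T n) t \<omega> \<longleftrightarrow> T n i \<omega> \<le> ereal t"
      and zero: "arrival_count (T n) 0 \<omega> = 0" if "\<omega> \<in> space M" for \<omega> i
    proof -
      interpret arrival_path "\<lambda>i. T n i \<omega>"
        using arr that by unfold_locales (auto simp: arrival_epochs_def)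
      have eq: "arrival_count (T n) u \<omega> = arrived u" for u
        by (simp add: arrival_count_def arrived_def)
      show "i < arrival_count (T n) t \<omega> \<longleftrightarrow> T n i \<omega> \<le> ereal t"
        unfolding eq by (rule epoch_le_iff[symmetric])
      show "arrival_count (T n) 0 \<omega> = 0"
        unfolding eq by (rule arrived_nonpos) simp
    qed
    have count: "arrival_count (T n) t \<in> measurable M (count_space UNIV)"
    proof (rule measurable_count_space_eq2_countable[THEN iffD2], intro conjI ballI)
      fix k :: nat
      \<comment> \<open>The epochs are increasing, so the count is determined by comparing single epochs with \<open>t\<close>.\<close>
      have "arrival_count (T n) t -` {k} \<inter> space M
          = {\<omega>\<in>space M. (\<forall>i<k. T n i \<omega> \<le> ereal t) \<and> \<not> T n k \<omega> \<le> ereal t}"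
        by (auto simp: iff[symmetric]) (metis linorder_neqE_nat less_irrefl)
      also have "\<dots> \<in> sets M" using T by measurable
      finally show "arrival_count (T n) t -` {k} \<inter> space M \<in> sets M" .
    qed auto
    show "(\<lambda>\<omega>. real (arrival_count (T n) t \<omega>) - real n * m) \<in> borel_measurable M"
      using measurable_compose[OF count, of real borel] by simp
    fix \<theta> :: real assume \<theta>: "\<bar>\<theta>\<bar> \<le> 1"
    have law: "prob {\<omega>\<in>space M. arrival_count (T n) t \<omega> = k} = (real n * m) ^ k / fact k * exp (- (real n * m))" for k
    proof -
      have "prob {\<omega>\<in>space M. arrival_count (T n) t \<omega> - arrival_count (T n) 0 \<omega> = k}
          = (LINT u:{0..t}|lebesgue. real n * lam u) ^ k / fact k * exp (- (LINT u:{0..t}|lebesgue. real n * lam u))"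
        using sys[OF n] t unfolding loss_system_def poisson_arrivals_def Let_def by blast
      moreover have "{\<omega>\<in>space M. arrival_count (T n) t \<omega> - arrival_count (T n) 0 \<omega> = k} = {\<omega>\<in>space M. arrival_count (T n) t \<omega> = k}"
        using zero by auto
      ultimately show ?thesis by (simp add: m_def)
    qed
    have "(\<integral>\<^sup>+\<omega>. ennreal (exp (\<theta> * (real (arrival_count (T n) t \<omega>) - real n * m))) \<partial>M) \<le> ennreal (exp (real n * m * \<theta>\<^sup>2))"
      using m by (intro poisson_exp_moment_le[OF count _ law \<theta>]) simp
    then show "(\<integral>\<^sup>+\<omega>. ennreal (exp (\<theta> * (real (arrival_count (T n) t \<omega>) - real n * m))) \<partial>M) \<le> ennreal (exp (real n * m * \<theta>\<^sup>2))" .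
  qed
  then show ?thesis
  proof eventually_elim
    case (elim \<omega>)
    have "eventually (\<lambda>n. (real (arrival_count (T n) t \<omega>) - real n * m) / real n + m = real (arrival_count (T n) t \<omega>) / real n) sequentially"
      using eventually_gt_at_top[of 0] by eventually_elim (simp add: field_simps)
    moreover have "(\<lambda>n. (real (arrival_count (T n) t \<omega>) - real n * m) / real n + m) \<longlonglongrightarrow> 0 + m"
      by (intro tendsto_add elim tendsto_const)
    ultimately show ?case
      by (simp add: m_def filterlim_cong)
  qed
qed

theorem theorem3p4:
  fixes M :: "'w measure"
    and lam F \<nu> \<rho> :: "real \<Rightarrow> real"
    and T :: "nat \<Rightarrow> nat \<Rightarrow> 'w \<Rightarrow> ereal"
    and S :: "nat \<Rightarrow> nat \<Rightarrow> 'w \<Rightarrow> real"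
    and R :: "nat \<Rightarrow> real \<Rightarrow> 'w \<Rightarrow> real"
    and t_max :: real
  assumes "prob_space M"
    and "intensity lam"
    and "service_distribution F \<nu>"
    and "\<And>n. n \<ge> 1 \<Longrightarrow> prob_space.loss_system M n lam F (T n) (S n) (R n)"
    and "volterra_solution lam F \<rho>"
    and "t_max > 0"
  shows "AE \<omega> in M. (\<lambda>n. SUP t\<in>{0..t_max}. \<bar>R n t \<omega> - \<rho> t\<bar>) \<longlonglongrightarrow> 0"
proof -
  interpret prob_space M by fact
  have H: "t_max + 1 \<ge> 0" using \<open>t_max > 0\<close> by simp
  obtain L where L: "finite_borel_measure L" "\<And>x. measure L {x} = 0" "measure L {..0} = 0"
    and L_int: "\<And>h t. t \<in> {0..t_max + 1} \<Longrightarrow> (\<lambda>u. indicator {0<..} u * h u) \<in> borel_measurable borel \<Longrightarrow>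
       (LINT u:{0..t}|lebesgue. h u * lam u) = (LINT u|L. indicator {0<..t} u * h u)"
    using intensity_measure[OF assms(2) H] by blast
  interpret fluid_input L F
    using L service_distribution_cdf[OF assms(3)]
    by (intro fluid_input.intro fluid_input_axioms.intro) auto
  have cdf_L: "cdf L t = (LINT u:{0..t}|lebesgue. lam u)" if t: "t \<in> {0..t_max + 1}" for t
  proof -
    have "(LINT u:{0..t}|lebesgue. 1 * lam u) = (LINT u|L. indicator {0<..t} u * 1)"
      by (rule L_int[OF t]) simp
    also have "\<dots> = measure L {0<..t}" by (simp add: borel_UNIV)
    also have "\<dots> = cdf L t - cdf L 0"
      using cdf_diff_eq[of 0 t] t by (cases "t = 0") auto
    finally show ?thesis using cdf_L_nonpos[of 0] by simp
  qed
  have leftlim: "\<exists>l. (\<rho> \<longlongrightarrow> l) (at_left t)" if "t > 0" for t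
    using assms(5) that by (auto simp: volterra_solution_def)
  have \<rho>0: "\<rho> 0 = 0" using assms(5) by (simp add: volterra_solution_def)
  have volterra: "\<rho> t = (LINT u|L. indicator {0<..t} u * (of_bool (left_lim \<rho> u < 1) * (1 - F (t - u))))"
    if t: "t \<in> {0<..t_max}" for t
  proof -
    have "\<rho> t = (LINT u:{0..t}|lebesgue. of_bool (left_lim \<rho> u < 1) * (1 - F (t - u)) * lam u)"
      using assms(5) t by (auto simp: volterra_solution_def)
    also have "\<dots> = (LINT u|L. indicator {0<..t} u * (of_bool (left_lim \<rho> u < 1) * (1 - F (t - u))))"
    proof (rule L_int)
      define h where "h u = (if 0 < u then left_lim \<rho> u else 0)" for u
      have [measurable]: "h \<in> borel_measurable borel"
        unfolding h_def by (rule left_lim_measurable[OF leftlim])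
      have "(\<lambda>u. indicator {0<..} u * (of_bool (left_lim \<rho> u < 1) * (1 - F (t - u))))
          = (\<lambda>u. indicator {0<..} u * ((if h u < 1 then 1 else 0) * (1 - F (t - u))))"
        by (auto simp: h_def fun_eq_iff indicator_def)
      then show "(\<lambda>u. indicator {0<..} u * (of_bool (left_lim \<rho> u < 1) * (1 - F (t - u)))) \<in> borel_measurable borel"
        by simp
    qed (use t in auto)
    finally show ?thesis .
  qed
  obtain G where G: "G \<in> sets borel" "\<And>u. u \<in> {0<..t_max} \<Longrightarrow> u \<in> G \<longleftrightarrow> fluid_occupancy G u < 1"
    "\<And>t. t \<in> {0..t_max} \<Longrightarrow> \<rho> t = fluid_occupancy G t"
    using volterra_occupancy[OF leftlim \<rho>0 volterra] by blast
  have countable_nonneg: "countable {q::real. q \<in> \<rat> \<and> P q}" for P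
    by (rule countable_subset[OF _ countable_rat]) auto
  have AE_arrivals: "AE \<omega> in M. \<forall>q\<in>{q. q \<in> \<rat> \<and> 0 \<le> q \<and> q \<le> t_max + 1}.
      (\<lambda>n. real (arrival_count (T n) q \<omega>) / real n) \<longlonglongrightarrow> cdf L q"
  proof (rule AE_ball_countable[THEN iffD2, OF countable_nonneg], intro ballI)
    fix q assume q: "q \<in> {q. q \<in> \<rat> \<and> 0 \<le> q \<and> q \<le> t_max + 1}"
    then have "cdf L q = (LINT u:{0..q}|lebesgue. lam u)" by (intro cdf_L) auto
    then show "AE \<omega> in M. (\<lambda>n. real (arrival_count (T n) q \<omega>) / real n) \<longlonglongrightarrow> cdf L q"
      using AE_arrival_fraction[OF assms(4,2), of q] q by auto
  qed
  have services: "indep_vars (\<lambda>_. borel) (S n) UNIV" "cdf (distr M borel (S n i)) = F" if "n \<ge> 1" for n i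
    using assms(4)[OF that] by (auto simp: loss_system_def iid_services_def)
  have AE_services: "AE \<omega> in M. \<forall>x\<in>\<rat>. \<forall>y\<in>{y. y \<in> \<rat> \<and> 0 \<le> y}.
      (\<lambda>n. (\<Sum>i<nat \<lfloor>y * real n\<rfloor>. of_bool (S n i \<omega> \<le> x)) / real n) \<longlonglongrightarrow> y * F x"
  proof (rule AE_ball_countable[THEN iffD2, OF countable_rat], rule ballI,
      rule AE_ball_countable[THEN iffD2, OF countable_nonneg], rule ballI)
    fix x y :: real assume "y \<in> {y. y \<in> \<rat> \<and> 0 \<le> y}"
    then show "AE \<omega> in M. (\<lambda>n. (\<Sum>i<nat \<lfloor>y * real n\<rfloor>. of_bool (S n i \<omega> \<le> x)) / real n) \<longlonglongrightarrow> y * F x"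
      by (intro AE_empirical_cdf services) simp_all
  qed
  show ?thesis
    using AE_arrivals AE_services AE_space
  proof eventually_elim
    case (elim \<omega>)
    interpret seq: loss_sequence L F "\<lambda>n i. T n i \<omega>" "\<lambda>n i. S n i \<omega>" "\<lambda>n t. R n t \<omega>" t_max
    proof (intro loss_sequence.intro loss_sequence_axioms.intro)
      show "fluid_input L F" by unfold_locales
    next
      fix n :: nat assume n: "n \<ge> 1"
      have "arrival_epochs M (T n)" "occupied_fraction M n (T n) (S n) (R n)"
        using assms(4)[OF n] by (auto simp: loss_system_def poisson_arrivals_def)
      then show "loss_path (\<lambda>i. T n i \<omega>) n (\<lambda>i. S n i \<omega>) (\<lambda>t. R n t \<omega>)"
        using elim(3) n by unfold_locales (auto simp: arrival_epochs_def occupied_fraction_def)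
    next
      fix q :: real assume q: "q \<in> \<rat>" "0 \<le> q" "q \<le> t_max + 1"
      have eq: "arrival_path.arrived (\<lambda>i. T n i \<omega>) q = arrival_count (T n) q \<omega>" if n: "n \<ge> 1" for n
      proof -
        have "arrival_epochs M (T n)"
          using assms(4)[OF n] by (auto simp: loss_system_def poisson_arrivals_def)
        then interpret arrival_path "\<lambda>i. T n i \<omega>"
          using elim(3) by unfold_locales (auto simp: arrival_epochs_def)
        show ?thesis
          by (simp add: arrived_def arrival_count_def)
      qed
      have "eventually (\<lambda>n. real (arrival_count (T n) q \<omega>) / real n
          = real (arrival_path.arrived (\<lambda>i. T n i \<omega>) q) / real n) sequentially"
        using eventually_ge_at_top[of 1] by eventually_elim (simp add: eq)
      moreover have "(\<lambda>n. real (arrival_count (T n) q \<omega>) / real n) \<longlonglongrightarrow> cdf L q"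
        using elim(1) q by auto
      ultimately show "(\<lambda>n. real (arrival_path.arrived (\<lambda>i. T n i \<omega>) q) / real n) \<longlonglongrightarrow> cdf L q"
        by (rule Lim_transform_eventually[rotated])
    next
      fix x y :: real assume "x \<in> \<rat>" "y \<in> \<rat>" "0 \<le> y"
      then show "(\<lambda>n. (\<Sum>i<nat \<lfloor>y * real n\<rfloor>. of_bool (S n i \<omega> \<le> x)) / real n) \<longlonglongrightarrow> y * F x"
        using elim(2) by auto
    qed
    show ?case
    proof (rule tendstoI)
      fix e :: real assume e: "e > 0"
      have "eventually (\<lambda>n. \<forall>t\<in>{0..t_max}. \<bar>R n t \<omega> - fluid_occupancy G t\<bar> \<le> 3 * (e / 6)) sequentially"
        using e \<open>t_max > 0\<close> by (intro seq.occupied_converges G(1,2)) auto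
      then show "eventually (\<lambda>n. dist (SUP t\<in>{0..t_max}. \<bar>R n t \<omega> - \<rho> t\<bar>) 0 < e) sequentially"
      proof eventually_elim
        case (elim n)
        then have le: "\<bar>R n t \<omega> - \<rho> t\<bar> \<le> e / 2" if "t \<in> {0..t_max}" for t
          using G(3)[OF that] that by auto
        have ne: "{0..t_max} \<noteq> {}" using \<open>t_max > 0\<close> by auto
        have "(SUP t\<in>{0..t_max}. \<bar>R n t \<omega> - \<rho> t\<bar>) \<le> e / 2"
          by (rule cSUP_least[OF ne le])
        moreover have "\<bar>R n 0 \<omega> - \<rho> 0\<bar> \<le> (SUP t\<in>{0..t_max}. \<bar>R n t \<omega> - \<rho> t\<bar>)"
          using le \<open>t_max > 0\<close> by (intro cSUP_upper bdd_aboveI2[where M = "e / 2"]) auto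
        ultimately show ?case
          using e abs_ge_zero[of "R n 0 \<omega> - \<rho> 0"] unfolding dist_real_def by linarith
      qed
    qed
  qed
qed

end
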